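(* Let $\mathtt g,d$ be positive integers, let $D\ge 2d$ be an integer, and let $\mathcal H$ be a complex Hilbert space. Then the convex cone of sums of squares $\mathcal C_d$ is closed in $\mathcal A_D$ with respect to the product weak operator topology.
   Context: $\langle x\rangle_d$ is the set of words of length at most $d$ in the free monoid on $x_1,\dots,x_{\mathtt g}$; $N(d)=\sum_{i=0}^d\mathtt g^i$ is its cardinality. $\mathcal A=\mathcal B(\mathcal H)\otimes\mathbb C\langle x\rangle$ consists of finite sums $p=\sum_wP_ww$, $P_w\in\mathcal B(\mathcal H)$, with involution $p^*=\sum_wP_w^*w^*$, $(x_{i_1}\cdots x_{i_n})^*=x_{i_n}\cdots x_{i_1}$; $\mathcal A_d$ is the subspace of polynomials of degree at most $d$. $\mathcal C_d=\{\sum_{i=1}^{N(d)}r_i^*r_i:\ r_i\in\mathcal A_d\}\subseteq\mathcal A_{2d}\subseteq\mathcal A_D$. The product weak operator topology (WOT) on $\mathcal A_D$ is the topology obtained by identifying $p=\sum_wP_ww$ with $(P_w)_w\in\mathcal B(\mathcal H)^{\langle x\rangle_D}$ and taking the product of the weak operator topologies: a net $p_\alpha=\sum_wP_{\alpha,w}w$ converges to $p$ iff $P_{\alpha,w}\to P_w$ in the WOT for each $w\in\langle x\rangle_D$. *)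

theory Defs
  imports "HOL-Analysis.Analysis"
begin

section \<open>Complex Hilbert spaces\<close>

text \<open>A complex Hilbert space is a Banach space with a compatible complex scalar multiplication
  whose norm comes from a complex inner product, linear in the first argument. Positive
  definiteness of the inner product is contained in \<open>cinner_self\<close> and the norm axioms.\<close>

class complex_hilbert_space = banach +
  fixes cscale :: "complex \<Rightarrow> 'a \<Rightarrow> 'a"
    and cinner :: "'a \<Rightarrow> 'a \<Rightarrow> complex"
  assumes cscale_add_right: "cscale c (x + y) = cscale c x + cscale c y"
    and cscale_add_left: "cscale (c + c') x = cscale c x + cscale c' x"
    and cscale_cscale: "cscale c (cscale c' x) = cscale (c * c') x"
    and cscale_of_real: "cscale (complex_of_real r) x = r *\<^sub>R x"
    and cinner_commute: "cinner x y = cnj (cinner y x)"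
    and cinner_add_left: "cinner (x + y) z = cinner x z + cinner y z"
    and cinner_cscale_left: "cinner (cscale c x) y = c * cinner x y"
    and cinner_self: "cinner x x = complex_of_real ((norm x)\<^sup>2)"

instantiation complex :: complex_hilbert_space
begin

definition "cscale c (z::complex) = c * z"

definition "cinner z (w::complex) = z * cnj w"

instance
proof
  fix x :: complex
  show "cinner x x = complex_of_real ((norm x)\<^sup>2)"
    unfolding cinner_complex_def by (metis complex_norm_square)
qed (simp_all add: cscale_complex_def cinner_complex_def algebra_simps scaleR_conv_of_real)

end


section \<open>Bounded operators and the weak operator topology\<close>

text \<open>\<open>'h \<Rightarrow>\<^sub>L 'h\<close> consists of the bounded real-linear maps, so complex homogeneity is imposed
  separately.\<close>

definition bounded_ops :: "('h::complex_hilbert_space \<Rightarrow>\<^sub>L 'h) set" where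
  "bounded_ops = {T. \<forall>c x. blinfun_apply T (cscale c x) = cscale c (blinfun_apply T x)}"

text \<open>By Riesz representation, every \<open>T \<in> bounded_ops\<close> has exactly one adjoint.\<close>

definition op_adj :: "('h::complex_hilbert_space \<Rightarrow>\<^sub>L 'h) \<Rightarrow> 'h \<Rightarrow>\<^sub>L 'h" where
  "op_adj T = (THE S. S \<in> bounded_ops \<and>
     (\<forall>x y. cinner (blinfun_apply T x) y = cinner x (blinfun_apply S y)))"

definition weak_operator_topology :: "('h::complex_hilbert_space \<Rightarrow>\<^sub>L 'h) topology" where
  "weak_operator_topology =
     pullback_topology bounded_ops (\<lambda>T (x, y). cinner (blinfun_apply T x) y)
       (product_topology (\<lambda>_. euclidean) UNIV)"

lemma limitin_pullback_topology:
  "limitin (pullback_topology A f T) g l F \<longleftrightarrow>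
     l \<in> A \<and> eventually (\<lambda>a. g a \<in> A) F \<and> limitin T (\<lambda>a. f (g a)) (f l) F"
    (is "?L \<longleftrightarrow> ?R")
proof
  assume L: ?L
  have l: "l \<in> A" "f l \<in> topspace T"
    using limitin_topspace[OF L] by (auto simp: topspace_pullback_topology)
  have ev: "eventually (\<lambda>a. g a \<in> f -` U \<inter> A) F" if "openin T U" "f l \<in> U" for U
    using L that l unfolding limitin_def openin_pullback_topology by blast
  have "eventually (\<lambda>a. g a \<in> A) F"
    using ev[OF openin_topspace l(2)] by (rule eventually_mono) auto
  moreover have "limitin T (\<lambda>a. f (g a)) (f l) F"
    unfolding limitin_def
  proof (intro conjI allI impI)
    show "f l \<in> topspace T" by (rule l)
    show "eventually (\<lambda>a. f (g a) \<in> U) F" if "openin T U \<and> f l \<in> U" for U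
      using ev[of U] that by (auto elim!: eventually_mono)
  qed
  ultimately show ?R using l by blast
next
  assume R: ?R
  then have "eventually (\<lambda>a. g a \<in> f -` U \<inter> A) F" if "openin T U" "f l \<in> U" for U
    using that unfolding limitin_def by (auto simp: eventually_conj_iff)
  then show ?L
    using R unfolding limitin_def openin_pullback_topology topspace_pullback_topology
    by auto
qed

lemma limitin_weak_operator_topology:
  "limitin weak_operator_topology T S F \<longleftrightarrow>
     S \<in> bounded_ops \<and> eventually (\<lambda>a. T a \<in> bounded_ops) F \<and>
     (\<forall>x y. ((\<lambda>a. cinner (blinfun_apply (T a) x) y) \<longlongrightarrow> cinner (blinfun_apply S x) y) F)"
  by (simp add: weak_operator_topology_def limitin_pullback_topology limitin_componentwise)


section \<open>Operator-valued noncommutative polynomials\<close>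

text \<open>The word \<open>x\<^bsub>i\<^sub>1\<^esub> \<dots> x\<^bsub>i\<^sub>n\<^esub>\<close> is the list of its indices, taken from \<open>{..<g}\<close>;
  the polynomial \<open>\<Sum>\<^sub>w P\<^sub>w w\<close> is its coefficient function \<open>w \<mapsto> P\<^sub>w\<close>.\<close>

type_synonym 'h ncpoly = "nat list \<Rightarrow> ('h \<Rightarrow>\<^sub>L 'h)"

definition words :: "nat \<Rightarrow> nat \<Rightarrow> nat list set" where
  "words g d = {w. set w \<subseteq> {..<g} \<and> length w \<le> d}"

definition num_words :: "nat \<Rightarrow> nat \<Rightarrow> nat" where
  "num_words g d = (\<Sum>i=0..d. g ^ i)"

definition ncpolys :: "nat \<Rightarrow> 'h::complex_hilbert_space ncpoly set" where
  "ncpolys g = {p. finite {w. p w \<noteq> 0} \<and> (\<forall>w. p w \<noteq> 0 \<longrightarrow> set w \<subseteq> {..<g}) \<and>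
     (\<forall>w. p w \<in> bounded_ops)}"

definition ncpolys_deg :: "nat \<Rightarrow> nat \<Rightarrow> 'h::complex_hilbert_space ncpoly set" where
  "ncpolys_deg g d = {p \<in> ncpolys g. \<forall>w. p w \<noteq> 0 \<longrightarrow> length w \<le> d}"

definition nc_adj :: "'h::complex_hilbert_space ncpoly \<Rightarrow> 'h ncpoly" where
  "nc_adj p = (\<lambda>w. op_adj (p (rev w)))"

definition nc_mult :: "'h::complex_hilbert_space ncpoly \<Rightarrow> 'h ncpoly \<Rightarrow> 'h ncpoly" where
  "nc_mult p q = (\<lambda>w. \<Sum>(u, v) \<in> {(u, v). u @ v = w}. p u o\<^sub>L q v)"

definition sos_cone :: "nat \<Rightarrow> nat \<Rightarrow> 'h::complex_hilbert_space ncpoly set" where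
  "sos_cone g d = {(\<lambda>w. \<Sum>i=1..num_words g d. nc_mult (nc_adj (r i)) (r i) w) | r.
     \<forall>i \<in> {1..num_words g d}. r i \<in> ncpolys_deg g d}"

lemma card_words: "card (words g d) = num_words g d"
proof -
  have "card (words g d) = (\<Sum>i\<le>d. card {..<g} ^ i)"
    unfolding words_def by (rule card_lists_length_le) simp
  then show ?thesis by (simp add: num_words_def atMost_atLeast0)
qed

text \<open>Elements of a product over \<open>words g D\<close> are \<open>undefined\<close> off the index set, whereas
  polynomials vanish there; \<open>restrict\<close> translates between the two.\<close>

definition product_wot :: "nat \<Rightarrow> nat \<Rightarrow> 'h::complex_hilbert_space ncpoly topology" where
  "product_wot g D =
     pullback_topology (ncpolys_deg g D) (\<lambda>p. restrict p (words g D))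
       (product_topology (\<lambda>_. weak_operator_topology) (words g D))"

lemma limitin_product_wot:
  "limitin (product_wot g D) p q F \<longleftrightarrow>
     q \<in> ncpolys_deg g D \<and> eventually (\<lambda>a. p a \<in> ncpolys_deg g D) F \<and>
     (\<forall>w \<in> words g D. limitin weak_operator_topology (\<lambda>a. p a w) (q w) F)"
proof -
  have "restrict r (words g D)
      \<in> topspace (product_topology (\<lambda>_. weak_operator_topology) (words g D))"
    if "r \<in> ncpolys_deg g D" for r :: "'a ncpoly"
    using that by (auto simp: ncpolys_deg_def ncpolys_def weak_operator_topology_def
        topspace_pullback_topology)
  then have "eventually (\<lambda>a. restrict (p a) (words g D)
      \<in> topspace (product_topology (\<lambda>_. weak_operator_topology) (words g D))) F"
    if "eventually (\<lambda>a. p a \<in> ncpolys_deg g D) F"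
    using that by (rule eventually_mono[rotated])
  then show ?thesis
    unfolding product_wot_def limitin_pullback_topology limitin_componentwise by auto
qed

end

theory Submission
  imports Defs
begin

text \<open>Write \<open>W\<close> for the set of words of length at most \<open>d\<close>. Expanding a sum of squares
  \<open>q = \<Sum>\<^sub>i r\<^sub>i\<^sup>* r\<^sub>i\<close> shows that the coefficient of \<open>q\<close> at \<open>w\<close> is the sum of \<open>A\<^sub>u\<^sub>v\<close> over the pairs
  \<open>u, v \<in> W\<close> with \<open>u\<^sup>* v = w\<close>, where \<open>A\<^sub>u\<^sub>v = \<Sum>\<^sub>i R\<^sub>i\<^sub>u\<^sup>* R\<^sub>i\<^sub>v\<close> is a positive block matrix. Conversely,
  every positive block matrix of bounded operators indexed by \<open>W\<close> has such a factorization with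
  \<open>card W\<close> many \<open>i\<close> (\<open>psd_kernel_factorization\<close>, an operator version of the Cholesky
  algorithm). So the cone consists of the polynomials \<open>\<Sum>\<^sub>u\<^sub>v A\<^sub>u\<^sub>v u\<^sup>* v\<close> with positive \<open>A\<close>.

  Let \<open>p\<close> be a limit of such polynomials. Positivity and the coefficient equations are preserved if
  the matrices also converge, which is a matter of bounding them. A net that converges in the weak
  operator topology need not be bounded in norm, but the bound can be found for each vector \<open>h\<close>
  separately: by \<open>weighted_diagonal_le\<close> there are constants, depending only on \<open>W\<close>, by which the
  diagonal values \<open>\<langle>A\<^sub>u\<^sub>u h, h\<rangle>\<close> are estimated linearly in terms of the values \<open>\<langle>q\<^sub>w h, h\<rangle>\<close> of
  the coefficients, and these converge. By the Cauchy--Schwarz inequality each number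
  \<open>\<langle>A\<^sub>u\<^sub>v h, k\<rangle>\<close> is then eventually bounded, and by Tychonoff's theorem
  (\<open>pointwise_convergent_refinement\<close>) all these numbers converge along a finer filter.

  The limit is at first only a positive kernel of sesquilinear forms. The same estimate, now for
  \<open>p\<close>, bounds its diagonal by a multiple of \<open>\<parallel>h\<parallel>\<^sup>2\<close>, and then the factorization applies to it and
  exhibits \<open>p\<close> as a sum of squares (\<open>sos_cone_if_psd_kernel\<close>). The factorization is stated for
  forms, so the limit never has to be turned into operators beforehand.

  The Hilbert space facts behind this are the representation of bounded forms by operators
  (\<open>form_representation\<close>, in a version relative to the closed range of an operator, which also
  provides the rows of the Cholesky factor) and the square root of a positive operator
  (\<open>positive_form_square_root\<close>).\<close>


section \<open>Complex inner products\<close>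

lemma cinner_add_right: "cinner x (y + z) = cinner x y + cinner x z"
  for x :: "'h::complex_hilbert_space"
  by (metis cinner_add_left cinner_commute complex_cnj_add)

lemma cinner_cscale_right: "cinner x (cscale c y) = cnj c * cinner x y"
  for x :: "'h::complex_hilbert_space"
  by (metis cinner_cscale_left cinner_commute complex_cnj_mult)

lemma cinner_scaleR_left: "cinner (r *\<^sub>R x) y = of_real r * cinner x y"
  for x :: "'h::complex_hilbert_space"
  by (metis cinner_cscale_left cscale_of_real)

lemma cinner_scaleR_right: "cinner x (r *\<^sub>R y) = of_real r * cinner x y"
  for x :: "'h::complex_hilbert_space"
  by (metis cinner_cscale_right complex_cnj_complex_of_real cscale_of_real)

lemma additive_cinner_left: "Modules.additive (\<lambda>x. cinner x (y :: 'h::complex_hilbert_space))"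
  by (simp add: Modules.additive_def cinner_add_left)

lemma additive_cinner_right: "Modules.additive (cinner (x :: 'h::complex_hilbert_space))"
  by (simp add: Modules.additive_def cinner_add_right)

lemmas cinner_zero_left [simp] = additive.zero [OF additive_cinner_left]
lemmas cinner_zero_right [simp] = additive.zero [OF additive_cinner_right]
lemmas cinner_diff_left = additive.diff [OF additive_cinner_left]
lemmas cinner_diff_right = additive.diff [OF additive_cinner_right]
lemmas cinner_sum_left = additive.sum [OF additive_cinner_left]
lemmas cinner_sum_right = additive.sum [OF additive_cinner_right]

lemma cinner_eq_zero_iff [simp]: "cinner x x = 0 \<longleftrightarrow> x = 0"
  for x :: "'h::complex_hilbert_space"
  by (simp add: cinner_self)

lemma Re_cinner_self: "Re (cinner x x) = (norm x)\<^sup>2"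
  for x :: "'h::complex_hilbert_space"
  by (simp add: cinner_self)

lemma Re_cinner_commute: "Re (cinner x y) = Re (cinner y x)"
  for x :: "'h::complex_hilbert_space"
  by (subst cinner_commute) simp

lemma norm_add_square: "(norm (x + y))\<^sup>2 = (norm x)\<^sup>2 + 2 * Re (cinner x y) + (norm y)\<^sup>2"
  for x :: "'h::complex_hilbert_space"
  by (simp add: Re_cinner_self [symmetric] cinner_add_left cinner_add_right Re_cinner_commute [of y x])

lemma norm_cscale: "norm (cscale c x) = cmod c * norm x"
  for x :: "'h::complex_hilbert_space"
proof -
  have "complex_of_real ((norm (cscale c x))\<^sup>2) = (c * cnj c) * cinner x x"
    by (simp only: cinner_self [symmetric] cinner_cscale_left cinner_cscale_right mult.assoc mult.left_commute)
  also have "\<dots> = complex_of_real ((cmod c * norm x)\<^sup>2)"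
    by (simp only: complex_norm_square [symmetric, of c] cinner_self power_mult_distrib of_real_mult)
  finally have "(norm (cscale c x))\<^sup>2 = (cmod c * norm x)\<^sup>2"
    by (simp only: of_real_eq_iff)
  then show ?thesis by simp
qed

lemma bounded_linear_cscale: "bounded_linear (cscale c :: 'h::complex_hilbert_space \<Rightarrow> 'h)"
proof (rule bounded_linear_intro)
  show "cscale c (r *\<^sub>R x) = r *\<^sub>R cscale c x" for r and x :: 'h
    by (simp add: cscale_of_real [symmetric] cscale_cscale mult.commute)
  show "norm (cscale c x) \<le> norm x * cmod c" for x :: 'h
    by (simp add: norm_cscale mult.commute)
qed (rule cscale_add_right)

lemma cscale_zero [simp]: "cscale c (0 :: 'h::complex_hilbert_space) = 0"
  by (rule linear_0 [OF bounded_linear.linear [OF bounded_linear_cscale]])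

text \<open>The discriminant argument behind the Cauchy--Schwarz inequalities for the inner product, for
  positive forms and for positive kernels of forms. The choice of \<open>c\<close> is a real multiple of the
  conjugate of \<open>z\<close>, which makes the linear term real.\<close>

lemma cmod_square_le_of_nonneg_quadratic:
  assumes q: "\<And>c. 0 \<le> a + 2 * Re (c * z) + (cmod c)\<^sup>2 * b" and b: "0 \<le> b"
  shows "(cmod z)\<^sup>2 \<le> a * b"
proof -
  define t where "t = (cmod z)\<^sup>2"
  have Re: "Re (complex_of_real r * cnj z * z) = r * t" for r
    unfolding t_def cmod_power2 by (simp add: algebra_simps power2_eq_square)
  have cm: "(cmod (complex_of_real r * cnj z))\<^sup>2 = r\<^sup>2 * t" for r
    unfolding t_def by (simp add: norm_mult power_mult_distrib)
  have q': "0 \<le> a + 2 * r * t + r\<^sup>2 * t * b" for r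
    using q [of "complex_of_real r * cnj z"] unfolding Re cm by simp
  show ?thesis
  proof (cases "b = 0")
    case True
    then have "0 \<le> a + 2 * r * t" for r
      using q' [of r] by simp
    from this [of "- (\<bar>a\<bar> + 1) / t"] have "t = 0"
      by (auto split: if_splits)
    then show ?thesis
      using True t_def by simp
  next
    case False
    have "0 \<le> a - t / b"
      using q' [of "- 1 / b"] False by (simp add: power2_eq_square field_simps)
    then show ?thesis
      using False b unfolding t_def [symmetric] by (simp add: field_simps)
  qed
qed

lemma cmod_cinner_le: "cmod (cinner x y) \<le> norm x * norm y"
  for x :: "'h::complex_hilbert_space"
proof -
  have "(cmod (cinner y x))\<^sup>2 \<le> (norm x)\<^sup>2 * (norm y)\<^sup>2"
  proof (rule cmod_square_le_of_nonneg_quadratic)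
    fix c
    have "0 \<le> (norm (x + cscale c y))\<^sup>2" by simp
    then show "0 \<le> (norm x)\<^sup>2 + 2 * Re (c * cinner y x) + (cmod c)\<^sup>2 * (norm y)\<^sup>2"
      by (simp only: norm_add_square norm_cscale power_mult_distrib
          Re_cinner_commute [of x "cscale c y"] cinner_cscale_left)
  qed simp
  then have "cmod (cinner y x) \<le> norm x * norm y"
    by (metis mult_nonneg_nonneg norm_ge_zero power2_le_imp_le power_mult_distrib)
  then show ?thesis
    by (metis cinner_commute complex_mod_cnj)
qed

lemma bounded_bilinear_cinner:
  "bounded_bilinear (cinner :: 'h::complex_hilbert_space \<Rightarrow> 'h \<Rightarrow> complex)"
proof
  show "\<exists>K. \<forall>a b. norm (cinner a (b::'h)) \<le> norm a * norm b * K"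
    by (rule exI [of _ 1]) (simp add: cmod_cinner_le)
qed (simp_all add: cinner_add_left cinner_add_right cinner_scaleR_left cinner_scaleR_right
    scaleR_conv_of_real)

lemmas tendsto_cinner = bounded_bilinear.tendsto [OF bounded_bilinear_cinner]

lemma cinner_eqI:
  assumes "\<And>k. cinner x k = cinner y (k :: 'h::complex_hilbert_space)"
  shows "x = y"
proof -
  have "cinner (x - y) (x - y) = 0"
    by (simp add: cinner_diff_left assms)
  then show ?thesis by simp
qed


section \<open>Representing forms by operators\<close>

definition clinear :: "('h::complex_hilbert_space \<Rightarrow> 'h) \<Rightarrow> bool" where
  "clinear f \<longleftrightarrow> (\<forall>x y. f (x + y) = f x + f y) \<and> (\<forall>c x. f (cscale c x) = cscale c (f x))"

definition sesquilinear :: "('h::complex_hilbert_space \<Rightarrow> 'h \<Rightarrow> complex) \<Rightarrow> bool" where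
  "sesquilinear f \<longleftrightarrow>
     (\<forall>x y z. f (x + y) z = f x z + f y z) \<and> (\<forall>c x z. f (cscale c x) z = c * f x z) \<and>
     (\<forall>x y z. f x (y + z) = f x y + f x z) \<and> (\<forall>c x z. f x (cscale c z) = cnj c * f x z)"

lemma clinearD:
  assumes "clinear f"
  shows "f (x + y) = f x + f y" "f (cscale c x) = cscale c (f x)"
    "f (r *\<^sub>R x) = r *\<^sub>R f x" "f 0 = 0"
proof -
  show add: "f (x + y) = f x + f y" for x y
    using assms by (simp add: clinear_def)
  show scale: "f (cscale c x) = cscale c (f x)" for c x
    using assms by (simp add: clinear_def)
  show "f (r *\<^sub>R x) = r *\<^sub>R f x"
    by (simp add: cscale_of_real [symmetric] scale)
  show "f 0 = 0"
    using add [of 0 0] by simp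
qed

lemma sesquilinearD:
  assumes "sesquilinear f"
  shows "f (x + y) z = f x z + f y z" "f (cscale c x) z = c * f x z"
    "f z (x + y) = f z x + f z y" "f z (cscale c x) = cnj c * f z x"
    "f (r *\<^sub>R x) z = of_real r * f x z" "f z (r *\<^sub>R x) = of_real r * f z x"
    "f 0 z = 0" "f z 0 = 0"
proof -
  show l: "f (x + y) z = f x z + f y z" for x y z
    using assms by (simp add: sesquilinear_def)
  show r: "f z (x + y) = f z x + f z y" for x y z
    using assms by (simp add: sesquilinear_def)
  show sl: "f (cscale c x) z = c * f x z" for c x z
    using assms by (simp add: sesquilinear_def)
  show sr: "f z (cscale c x) = cnj c * f z x" for c x z
    using assms by (simp add: sesquilinear_def)
  show "f (r *\<^sub>R x) z = of_real r * f x z" "f z (r *\<^sub>R x) = of_real r * f z x"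
    using sl [of "of_real r" x z] sr [of z "of_real r" x] by (simp_all add: cscale_of_real)
  show "f 0 z = 0" "f z 0 = 0"
    using l [of 0 0 z] r [of z 0 0] by simp_all
qed

lemma bounded_ops_clinear: "T \<in> bounded_ops \<Longrightarrow> clinear (blinfun_apply T)"
  by (simp add: bounded_ops_def clinear_def blinfun.bilinear_simps)

lemma sesquilinear_cinner: "sesquilinear (\<lambda>h k. cinner (S h) (T k))" if "clinear S" "clinear T"
  by (simp add: sesquilinear_def clinearD [OF that(1)] clinearD [OF that(2)] cinner_add_left
      cinner_add_right cinner_cscale_left cinner_cscale_right)

lemma sesquilinear_diff:
  assumes "sesquilinear f" "sesquilinear g"
  shows "sesquilinear (\<lambda>h k. f h k - g h k)"
  using sesquilinearD [OF assms(1)] sesquilinearD [OF assms(2)]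
  by (simp add: sesquilinear_def algebra_simps)

lemma quadratic_nonneg_imp_linear_zero:
  fixes a b :: real
  assumes "\<And>t. 0 \<le> 2 * t * a + t\<^sup>2 * b" and "0 \<le> b"
  shows "a = 0"
proof (rule ccontr)
  assume a: "a \<noteq> 0"
  have "0 \<le> 2 * (- a / (b + 1)) * a + (- a / (b + 1))\<^sup>2 * b"
    by (rule assms)
  also have "\<dots> = - (a\<^sup>2 * (b + 2)) / (b + 1)\<^sup>2"
    using \<open>0 \<le> b\<close> by (simp add: divide_simps) (simp add: algebra_simps power2_eq_square)
  also have "\<dots> < 0"
    using a \<open>0 \<le> b\<close> by simp
  finally show False by simp
qed

lemma closure_range_add:
  assumes S: "clinear S" and "x \<in> closure (range S)" "y \<in> closure (range S)"
  shows "x + y \<in> closure (range S)"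
proof -
  obtain a b where a: "\<And>n. a n \<in> range S" "a \<longlonglongrightarrow> x" and b: "\<And>n. b n \<in> range S" "b \<longlonglongrightarrow> y"
    using assms(2,3) unfolding closure_sequential by metis
  have "a n + b n \<in> range S" for n
    using a(1) [of n] b(1) [of n] by (auto simp: clinearD(1) [OF S, symmetric])
  with tendsto_add [OF a(2) b(2)] show ?thesis
    unfolding closure_sequential by (intro exI [of _ "\<lambda>n. a n + b n"]) simp
qed

lemma closure_range_cscale:
  assumes S: "clinear S" and "x \<in> closure (range S)"
  shows "cscale c x \<in> closure (range S)"
proof -
  obtain a where a: "\<And>n. a n \<in> range S" "a \<longlonglongrightarrow> x"
    using assms(2) unfolding closure_sequential by metis
  have "cscale c (a n) \<in> range S" for n
    using a(1) [of n] by (metis clinearD(2) [OF S] imageE rangeI)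
  with bounded_linear.tendsto [OF bounded_linear_cscale a(2), of c] show ?thesis
    unfolding closure_sequential by metis
qed

lemma closure_range_zero: "clinear S \<Longrightarrow> 0 \<in> closure (range S)"
  by (metis clinearD(4) closure_subset rangeI subsetD)

lemma closure_range_sum:
  assumes S: "clinear S" and "\<And>i. i \<in> I \<Longrightarrow> x i \<in> closure (range S)"
  shows "(\<Sum>i\<in>I. x i) \<in> closure (range S)"
  using assms(2)
  by (induction I rule: infinite_finite_induct)
    (auto simp: closure_range_zero [OF S] closure_range_add [OF S])

lemma closure_range_orthogonal_eq_zero:
  assumes "x \<in> closure (range S)" and orth: "\<And>k. cinner x (S k) = 0"
  shows "x = (0 :: 'h::complex_hilbert_space)"
proof -
  obtain a where a: "\<And>n. a n \<in> range S" "a \<longlonglongrightarrow> x"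
    using assms(1) unfolding closure_sequential by metis
  have "(\<lambda>n. cinner x (a n)) \<longlonglongrightarrow> cinner x x"
    by (intro tendsto_cinner tendsto_const a)
  moreover have "cinner x (a n) = 0" for n
    using a(1) [of n] orth by auto
  ultimately have "cinner x x = 0"
    by (simp add: LIMSEQ_const_iff)
  then show ?thesis by simp
qed

lemma closure_range_inner_unique:
  assumes S: "clinear S" and x: "x \<in> closure (range S)" and y: "y \<in> closure (range S)"
    and eq: "\<And>k. cinner x (S k) = cinner y (S k)"
  shows "x = y"
proof -
  have neg: "cscale (-1) z = - z" for z :: 'a
    using cscale_of_real [of "-1" z] by simp
  have "x + cscale (-1) y \<in> closure (range S)"
    by (intro closure_range_add closure_range_cscale S x y)
  then have "x - y = 0"
    by (intro closure_range_orthogonal_eq_zero [where S = S]) (simp_all add: neg cinner_diff_left eq)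
  then show ?thesis by simp
qed

text \<open>A functional dominated by \<open>\<parallel>S k\<parallel>\<close> factors through \<open>S\<close> and is then represented by a vector of
  the closed range: minimise \<open>\<parallel>S k\<parallel>\<^sup>2 - 2 Re (\<phi> k)\<close>. The parallelogram law makes \<open>S\<close> of a minimising
  sequence Cauchy, and the first variation at its limit is the representation. For the identity
  this is the Riesz representation theorem.\<close>

lemma functional_representation:
  fixes S :: "'h::complex_hilbert_space \<Rightarrow> 'h" and \<phi> :: "'h \<Rightarrow> complex"
  assumes S: "clinear S"
    and add: "\<And>x y. \<phi> (x + y) = \<phi> x + \<phi> y" and scale: "\<And>c x. \<phi> (cscale c x) = cnj c * \<phi> x"
    and bound: "\<And>k. cmod (\<phi> k) \<le> c * norm (S k)"
  obtains x where "x \<in> closure (range S)" "\<And>k. \<phi> k = cinner x (S k)"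
proof -
  define J where "J k = (norm (S k))\<^sup>2 - 2 * Re (\<phi> k)" for k
  define m where "m = Inf (range J)"
  have \<phi>R: "\<phi> (r *\<^sub>R x) = of_real r * \<phi> x" for r x
    using scale [of "of_real r" x] by (simp add: cscale_of_real)
  have "- c\<^sup>2 \<le> J k" for k
  proof -
    have "Re (\<phi> k) \<le> c * norm (S k)"
      using bound [of k] complex_Re_le_cmod [of "\<phi> k"] by linarith
    moreover have "0 \<le> (norm (S k) - c)\<^sup>2" by simp
    ultimately show ?thesis
      unfolding J_def by (simp add: power2_diff algebra_simps)
  qed
  then have bdd: "bdd_below (range J)"
    by (auto intro!: bdd_belowI [of _ "- c\<^sup>2"])
  have mJ: "m \<le> J k" for k
    unfolding m_def by (rule cInf_lower [OF _ bdd]) simp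
  have "\<exists>k. J k < m + inverse (real (Suc n))" for n
    using cInf_lessD [of "range J" "m + inverse (real (Suc n))"] unfolding m_def by auto
  then obtain k where k: "\<And>n. J (k n) < m + inverse (real (Suc n))"
    by metis
  have expand: "J (x + y) = J x + 2 * Re (cinner (S x) (S y)) + (norm (S y))\<^sup>2 - 2 * Re (\<phi> y)" for x y
    by (simp add: J_def clinearD(1) [OF S] norm_add_square add)
  have par: "(norm (S x - S y))\<^sup>2 = 2 * (J x + J y) - 4 * J ((1/2) *\<^sub>R (x + y))" for x y
  proof -
    have "(norm (S x - S y))\<^sup>2 = (norm (S x))\<^sup>2 - 2 * Re (cinner (S x) (S y)) + (norm (S y))\<^sup>2"
      using norm_add_square [of "S x" "- S y"] cinner_scaleR_right [of "S x" "-1" "S y"] by simp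
    moreover have "J ((1/2) *\<^sub>R (x + y)) = (norm (S x + S y))\<^sup>2 / 4 - Re (\<phi> x + \<phi> y)"
      unfolding J_def clinearD(1,3) [OF S] \<phi>R add norm_scaleR power_mult_distrib
      by (simp add: power_divide field_simps)
    ultimately show ?thesis
      by (simp add: J_def norm_add_square algebra_simps)
  qed
  have close: "(norm (S (k i) - S (k j)))\<^sup>2 \<le> 2 * (inverse (real (Suc i)) + inverse (real (Suc j)))"
    for i j
    using par [of "k i" "k j"] k [of i] k [of j] mJ [of "(1/2) *\<^sub>R (k i + k j)"] by simp
  have "Cauchy (\<lambda>n. S (k n))"
  proof (rule metric_CauchyI)
    fix e :: real assume e: "0 < e"
    obtain M where M: "inverse (real (Suc M)) < e\<^sup>2 / 4"
      using reals_Archimedean [of "e\<^sup>2 / 4"] e by auto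
    have "dist (S (k i)) (S (k j)) < e" if "M \<le> i" "M \<le> j" for i j
    proof -
      have "inverse (real (Suc i)) \<le> inverse (real (Suc M))"
        "inverse (real (Suc j)) \<le> inverse (real (Suc M))"
        using that by (simp_all add: le_imp_inverse_le)
      then have "2 * (inverse (real (Suc i)) + inverse (real (Suc j)))
          \<le> 2 * (inverse (real (Suc M)) + inverse (real (Suc M)))"
        by (intro mult_left_mono add_mono) simp_all
      also have "\<dots> < e\<^sup>2"
        using M by simp
      finally have "(norm (S (k i) - S (k j)))\<^sup>2 < e\<^sup>2"
        by (rule order.strict_trans1 [OF close])
      then show ?thesis
        using e by (simp add: dist_norm power2_less_imp_less)
    qed
    then show "\<exists>M. \<forall>i\<ge>M. \<forall>j\<ge>M. dist (S (k i)) (S (k j)) < e" by blast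
  qed
  then obtain x where x: "(\<lambda>n. S (k n)) \<longlonglongrightarrow> x"
    by (metis Cauchy_convergent convergent_def)
  have Re_eq: "Re (\<phi> y) = Re (cinner x (S y))" for y
  proof -
    have "0 \<le> 2 * t * Re (cinner x (S y) - \<phi> y) + t\<^sup>2 * (norm (S y))\<^sup>2" for t
    proof -
      let ?b = "\<lambda>z. 2 * t * Re (cinner z (S y) - \<phi> y) + t\<^sup>2 * (norm (S y))\<^sup>2"
      have "- inverse (real (Suc n)) \<le> ?b (S (k n))" for n
      proof -
        have "J (k n + t *\<^sub>R y) = J (k n) + ?b (S (k n))"
          by (simp add: expand clinearD(3) [OF S] \<phi>R cinner_scaleR_right power_mult_distrib
              algebra_simps)
        then show ?thesis
          using k [of n] mJ [of "k n + t *\<^sub>R y"] by linarith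
      qed
      moreover have "(\<lambda>n. ?b (S (k n))) \<longlonglongrightarrow> ?b x"
        by (intro tendsto_intros tendsto_cinner x)
      moreover have "(\<lambda>n. - inverse (real (Suc n))) \<longlonglongrightarrow> - 0"
        by (intro tendsto_minus LIMSEQ_inverse_real_of_nat)
      ultimately have "- 0 \<le> ?b x"
        by (intro tendsto_le [OF sequentially_bot _ _ always_eventually]) auto
      then show ?thesis by simp
    qed
    then have "Re (cinner x (S y) - \<phi> y) = 0"
      by (rule quadratic_nonneg_imp_linear_zero) simp
    then show ?thesis by simp
  qed
  have "\<phi> y = cinner x (S y)" for y
    using Re_eq [of y] Re_eq [of "cscale \<i> y"]
    by (simp add: complex_eq_iff scale clinearD(2) [OF S] cinner_cscale_right)
  moreover have "x \<in> closure (range S)"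
    using x unfolding closure_sequential by (intro exI [of _ "\<lambda>n. S (k n)"]) simp
  ultimately show ?thesis
    using that by blast
qed

text \<open>Uniqueness of the representing vector inside the closed range makes its dependence on \<open>h\<close>
  linear. Without the restriction to the closed range, \<open>X h\<close> would only be determined modulo
  the orthogonal complement of the range.\<close>

lemma form_representation:
  fixes S :: "'h::complex_hilbert_space \<Rightarrow> 'h" and f :: "'h \<Rightarrow> 'h \<Rightarrow> complex"
  assumes S: "clinear S" and f: "sesquilinear f" and c: "0 \<le> c"
    and bound: "\<And>h k. cmod (f h k) \<le> c * norm h * norm (S k)"
  obtains X where "X \<in> bounded_ops" "norm X \<le> c" "\<And>h. blinfun_apply X h \<in> closure (range S)"
    "\<And>h k. f h k = cinner (blinfun_apply X h) (S k)"
proof -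
  have "\<exists>x. x \<in> closure (range S) \<and> (\<forall>k. f h k = cinner x (S k))" for h
    by (rule functional_representation [OF S, of "f h" "c * norm h"])
      (auto simp: sesquilinearD [OF f] bound)
  then obtain X where X: "\<And>h. X h \<in> closure (range S)" "\<And>h k. f h k = cinner (X h) (S k)"
    by metis
  have Xadd: "X (a + b) = X a + X b" for a b
    by (rule closure_range_inner_unique [OF S])
      (auto simp: X(1) closure_range_add [OF S] cinner_add_left X(2) [symmetric] sesquilinearD [OF f])
  have Xscale: "X (cscale r a) = cscale r (X a)" for r a
    by (rule closure_range_inner_unique [OF S])
      (auto simp: X(1) closure_range_cscale [OF S] cinner_cscale_left X(2) [symmetric]
        sesquilinearD [OF f])
  have Xbound: "norm (X h) \<le> c * norm h" for h
  proof -
    obtain a where a: "\<And>n. a n \<in> range S" "a \<longlonglongrightarrow> X h"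
      using X(1) [of h] unfolding closure_sequential by metis
    have "cmod (cinner (X h) (a n)) \<le> c * norm h * norm (a n)" for n
      using a(1) [of n] bound [of h] by (auto simp: X(2))
    moreover have "(\<lambda>n. cmod (cinner (X h) (a n))) \<longlonglongrightarrow> cmod (cinner (X h) (X h))"
      by (intro tendsto_norm tendsto_cinner tendsto_const a)
    moreover have "(\<lambda>n. c * norm h * norm (a n)) \<longlonglongrightarrow> c * norm h * norm (X h)"
      by (intro tendsto_intros a)
    ultimately have "cmod (cinner (X h) (X h)) \<le> c * norm h * norm (X h)"
      by (intro LIMSEQ_le) auto
    then have "norm (X h) * norm (X h) \<le> c * norm h * norm (X h)"
      by (simp add: cinner_self norm_power power2_eq_square norm_mult)
    then show ?thesis
      using c by (cases "norm (X h) = 0") (auto simp: mult_le_cancel_right)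
  qed
  have bl: "bounded_linear X"
  proof (rule bounded_linear_intro)
    show "X (r *\<^sub>R a) = r *\<^sub>R X a" for r a
      by (simp add: cscale_of_real [symmetric] Xscale)
    show "norm (X a) \<le> norm a * c" for a
      using Xbound [of a] by (simp add: mult.commute)
  qed (rule Xadd)
  have ap: "blinfun_apply (Blinfun X) = X"
    by (rule bounded_linear_Blinfun_apply [OF bl])
  show ?thesis
  proof (rule that [of "Blinfun X"])
    show "norm (Blinfun X) \<le> c"
      by (rule norm_blinfun_bound) (simp_all add: ap c Xbound)
  qed (simp_all add: ap X(1) X(2) [symmetric] bounded_ops_def Xscale)
qed

text \<open>The case \<open>S = id\<close>: bounded sesquilinear forms are given by bounded operators. It supplies the
  adjoint, and every operator that is defined below through its quadratic form.\<close>

lemma bounded_form_representation: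
  fixes f :: "'h::complex_hilbert_space \<Rightarrow> 'h \<Rightarrow> complex"
  assumes "sesquilinear f" "0 \<le> c" "\<And>h k. cmod (f h k) \<le> c * norm h * norm k"
  obtains A where "A \<in> bounded_ops" "norm A \<le> c" "\<And>h k. f h k = cinner (blinfun_apply A h) k"
proof (rule form_representation [of "\<lambda>k. k" f c])
  show "clinear (\<lambda>k::'h. k)" by (simp add: clinear_def)
qed (use assms that in auto)

lemma op_adj:
  fixes T :: "'h::complex_hilbert_space \<Rightarrow>\<^sub>L 'h"
  assumes T: "T \<in> bounded_ops"
  shows "op_adj T \<in> bounded_ops"
    and "cinner (blinfun_apply (op_adj T) x) y = cinner x (blinfun_apply T y)"
proof -
  have "clinear (\<lambda>x::'h. x)" by (simp add: clinear_def)
  then have "sesquilinear (\<lambda>h k. cinner h (blinfun_apply T k))"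
    using sesquilinear_cinner [OF _ bounded_ops_clinear [OF T]] by blast
  moreover have "cmod (cinner h (blinfun_apply T k)) \<le> norm T * norm h * norm k" for h k
  proof -
    have "cmod (cinner h (blinfun_apply T k)) \<le> norm h * norm (blinfun_apply T k)"
      by (rule cmod_cinner_le)
    also have "\<dots> \<le> norm h * (norm T * norm k)"
      by (intro mult_left_mono norm_blinfun) simp
    finally show ?thesis by (simp add: mult.left_commute mult.assoc)
  qed
  ultimately obtain A where A: "A \<in> bounded_ops"
      "\<And>h k. cinner h (blinfun_apply T k) = cinner (blinfun_apply A h) k"
    by (rule bounded_form_representation [OF _ norm_ge_zero]) auto
  have "cinner (blinfun_apply T x) y = cinner x (blinfun_apply A y)" for x y
    using A(2) [of y x] cinner_commute [of "blinfun_apply T x" y]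
      cinner_commute [of x "blinfun_apply A y"] by simp
  with A have adj: "A \<in> bounded_ops \<and>
      (\<forall>x y. cinner (blinfun_apply T x) y = cinner x (blinfun_apply A y))"
    by blast
  have "op_adj T = A"
    unfolding op_adj_def
  proof (rule the_equality)
    show "A \<in> bounded_ops \<and>
        (\<forall>x y. cinner (blinfun_apply T x) y = cinner x (blinfun_apply A y))"
      by (rule adj)
    fix B assume B: "B \<in> bounded_ops \<and>
      (\<forall>x y. cinner (blinfun_apply T x) y = cinner x (blinfun_apply B y))"
    show "B = A"
    proof (rule blinfun_eqI, rule cinner_eqI)
      show "cinner (blinfun_apply B h) k = cinner (blinfun_apply A h) k" for h k
        using B adj cinner_commute [of "blinfun_apply B h" k]
          cinner_commute [of "blinfun_apply A h" k] by simp
    qed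
  qed
  with A show "op_adj T \<in> bounded_ops"
    and "cinner (blinfun_apply (op_adj T) x) y = cinner x (blinfun_apply T y)"
    by simp_all
qed


section \<open>Square roots of positive forms\<close>

lemma Re_polarization:
  "Re (a + z + cnj z + (c * cnj c) * b) = Re a + 2 * Re z + (cmod c)\<^sup>2 * Re b"
  unfolding cmod_power2 by (simp add: algebra_simps power2_eq_square)

lemma positive_form_Cauchy_Schwarz:
  assumes f: "sesquilinear f" and herm: "\<And>h k. f h k = cnj (f k h)" and pos: "\<And>h. 0 \<le> Re (f h h)"
  shows "(cmod (f h k))\<^sup>2 \<le> Re (f h h) * Re (f k k)"
proof (rule cmod_square_le_of_nonneg_quadratic)
  fix c
  have "f (h + cscale (cnj c) k) (h + cscale (cnj c) k)
      = f h h + c * f h k + cnj (c * f h k) + (c * cnj c) * f k k"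
    by (simp add: sesquilinearD [OF f] herm [of k h] algebra_simps)
  then have "Re (f (h + cscale (cnj c) k) (h + cscale (cnj c) k))
      = Re (f h h) + 2 * Re (c * f h k) + (cmod c)\<^sup>2 * Re (f k k)"
    by (simp only: Re_polarization)
  then show "0 \<le> Re (f h h) + 2 * Re (c * f h k) + (cmod c)\<^sup>2 * Re (f k k)"
    using pos [of "h + cscale (cnj c) k"] by simp
qed (rule pos)

lemma bounded_ops_zero: "0 \<in> bounded_ops"
  by (simp add: bounded_ops_def)

lemma bounded_ops_add: "S \<in> bounded_ops \<Longrightarrow> T \<in> bounded_ops \<Longrightarrow> S + T \<in> bounded_ops"
  by (simp add: bounded_ops_def blinfun.bilinear_simps cscale_add_right)

lemma bounded_ops_scaleR: "T \<in> bounded_ops \<Longrightarrow> r *\<^sub>R T \<in> bounded_ops"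
  by (simp add: bounded_ops_def blinfun.bilinear_simps cscale_of_real [symmetric] cscale_cscale
      mult.commute)

lemma bounded_ops_compose: "S \<in> bounded_ops \<Longrightarrow> T \<in> bounded_ops \<Longrightarrow> S o\<^sub>L T \<in> bounded_ops"
  by (simp add: bounded_ops_def)

lemma bounded_ops_sum: "(\<And>i. i \<in> I \<Longrightarrow> T i \<in> bounded_ops) \<Longrightarrow> (\<Sum>i\<in>I. T i) \<in> bounded_ops"
  by (induction I rule: infinite_finite_induct) (auto simp: bounded_ops_zero bounded_ops_add)

lemma bounded_ops_id: "id_blinfun \<in> bounded_ops"
  by (simp add: bounded_ops_def)

lemma bounded_ops_limit:
  assumes "Y \<longlonglongrightarrow> T" and "\<And>n. Y n \<in> bounded_ops"
  shows "T \<in> bounded_ops"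
  unfolding bounded_ops_def
proof (intro CollectI allI)
  fix c x
  have "(\<lambda>n. blinfun_apply (Y n) (cscale c x)) \<longlonglongrightarrow> blinfun_apply T (cscale c x)"
    by (intro blinfun.tendsto assms tendsto_const)
  moreover have "(\<lambda>n. cscale c (blinfun_apply (Y n) x)) \<longlonglongrightarrow> cscale c (blinfun_apply T x)"
    by (intro bounded_linear.tendsto [OF bounded_linear_cscale] blinfun.tendsto assms tendsto_const)
  moreover have "blinfun_apply (Y n) (cscale c x) = cscale c (blinfun_apply (Y n) x)" for n
    using assms(2) [of n] by (simp add: bounded_ops_def)
  ultimately show "blinfun_apply T (cscale c x) = cscale c (blinfun_apply T x)"
    by (simp add: LIMSEQ_unique)
qed

text \<open>Complex linearity is part of the notion because the iteration below must stay among the complex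
  linear operators.\<close>

definition symmetric_op :: "('h::complex_hilbert_space \<Rightarrow>\<^sub>L 'h) \<Rightarrow> bool" where
  "symmetric_op T \<longleftrightarrow> T \<in> bounded_ops \<and>
     (\<forall>h k. cinner (blinfun_apply T h) k = cinner h (blinfun_apply T k))"

lemma symmetric_op_limit:
  assumes Y: "Y \<longlonglongrightarrow> T" and "\<And>n. symmetric_op (Y n)"
  shows "symmetric_op T"
  unfolding symmetric_op_def
proof (intro conjI allI)
  show "T \<in> bounded_ops"
    using assms bounded_ops_limit unfolding symmetric_op_def by blast
  fix h k
  have "(\<lambda>n. cinner (blinfun_apply (Y n) h) k) \<longlonglongrightarrow> cinner (blinfun_apply T h) k"
    "(\<lambda>n. cinner h (blinfun_apply (Y n) k)) \<longlonglongrightarrow> cinner h (blinfun_apply T k)"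
    by (intro tendsto_cinner blinfun.tendsto Y tendsto_const)+
  moreover have "cinner (blinfun_apply (Y n) h) k = cinner h (blinfun_apply (Y n) k)" for n
    using assms(2) [of n] by (simp add: symmetric_op_def)
  ultimately show "cinner (blinfun_apply T h) k = cinner h (blinfun_apply T k)"
    by (simp add: LIMSEQ_unique)
qed

text \<open>To solve \<open>(1 - Y)\<^sup>2 = 1 - B\<close> when \<open>\<parallel>B\<parallel> \<le> 1\<close>, iterate \<open>Y \<mapsto> (B + Y\<^sup>2) / 2\<close> from \<open>0\<close>. Each
  iterate, and each difference of consecutive iterates, is a polynomial in \<open>B\<close> with nonnegative
  coefficients, so its norm is at most the value of that polynomial at \<open>1\<close>. These values form a
  bounded increasing sequence of reals, whence the operator iteration converges in norm even on the
  boundary \<open>\<parallel>B\<parallel> = 1\<close>.\<close>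

primrec majorant :: "nat \<Rightarrow> real" where
  "majorant 0 = 0"
| "majorant (Suc n) = (1 + (majorant n)\<^sup>2) / 2"

lemma majorant_bounds: "0 \<le> majorant n \<and> majorant n \<le> 1"
proof (induction n)
  case (Suc n)
  then have "(majorant n)\<^sup>2 \<le> 1" by (simp add: power_le_one)
  then show ?case by simp
qed simp

lemma majorant_le_Suc: "majorant n \<le> majorant (Suc n)"
proof -
  have "0 \<le> (1 - majorant n)\<^sup>2" by simp
  then show ?thesis by (simp add: power2_diff)
qed

lemma summable_majorant_increments: "summable (\<lambda>n. majorant (Suc n) - majorant n)"
proof -
  have "incseq majorant"
    by (rule incseq_SucI) (rule majorant_le_Suc)
  then obtain L where "majorant \<longlonglongrightarrow> L"
    using incseq_convergent [of majorant 1] majorant_bounds by blast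
  then show ?thesis
    using telescope_summable by blast
qed

primrec root_iter :: "('h::complex_hilbert_space \<Rightarrow>\<^sub>L 'h) \<Rightarrow> nat \<Rightarrow> 'h \<Rightarrow>\<^sub>L 'h" where
  "root_iter B 0 = 0"
| "root_iter B (Suc n) = (1/2) *\<^sub>R (B + (root_iter B n o\<^sub>L root_iter B n))"

lemma symmetric_op_root_iter:
  assumes "symmetric_op B"
  shows "symmetric_op (root_iter B n)"
proof (induction n)
  case 0
  show ?case by (simp add: symmetric_op_def bounded_ops_zero)
next
  case (Suc n)
  with assms show ?case
    by (simp add: symmetric_op_def bounded_ops_scaleR bounded_ops_add bounded_ops_compose
        blinfun.bilinear_simps cinner_scaleR_left cinner_scaleR_right cinner_add_left
        cinner_add_right)
qed

lemma norm_root_iter_le: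
  assumes "norm B \<le> 1"
  shows "norm (root_iter B n) \<le> majorant n"
proof (induction n)
  case (Suc n)
  have "norm (root_iter B n o\<^sub>L root_iter B n) \<le> norm (root_iter B n) * norm (root_iter B n)"
    by (rule norm_blinfun_compose)
  also have "\<dots> \<le> (majorant n)\<^sup>2"
    unfolding power2_eq_square using Suc by (intro mult_mono) (auto simp: majorant_bounds)
  finally have "norm (B + (root_iter B n o\<^sub>L root_iter B n)) \<le> 1 + (majorant n)\<^sup>2"
    using assms by (intro norm_triangle_le) linarith
  then show ?case by simp
qed simp

lemma norm_root_iter_increment_le:
  assumes B: "norm B \<le> 1"
  shows "norm (root_iter B (Suc n) - root_iter B n) \<le> majorant (Suc n) - majorant n"
proof (induction n)
  case 0
  show ?case using B by simp
next
  case (Suc n)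
  define Y Z where "Y = root_iter B (Suc n)" and "Z = root_iter B n"
  define y z where "y = majorant (Suc n)" and "z = majorant n"
  have nY: "norm Y \<le> y" and nZ: "norm Z \<le> z" and d: "norm (Y - Z) \<le> y - z"
    and pos: "0 \<le> y" "0 \<le> z"
    using norm_root_iter_le [OF B] Suc majorant_bounds by (simp_all only: Y_def Z_def y_def z_def)
  have "(Y o\<^sub>L Y) - (Z o\<^sub>L Z) = (Y o\<^sub>L (Y - Z)) + ((Y - Z) o\<^sub>L Z)"
    by (rule blinfun_eqI) (simp add: blinfun.bilinear_simps)
  then have "norm ((Y o\<^sub>L Y) - (Z o\<^sub>L Z)) \<le> norm Y * norm (Y - Z) + norm (Y - Z) * norm Z"
    by (metis norm_blinfun_compose norm_triangle_le add_mono)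
  also have "\<dots> \<le> y * (y - z) + (y - z) * z"
    using nY nZ d pos order_trans [OF norm_ge_zero d] by (intro add_mono mult_mono) (auto intro: order_trans [OF norm_ge_zero])
  finally have *: "norm ((Y o\<^sub>L Y) - (Z o\<^sub>L Z)) \<le> y\<^sup>2 - z\<^sup>2"
    by (simp add: algebra_simps power2_eq_square)
  have "root_iter B (Suc (Suc n)) - root_iter B (Suc n) = (1/2) *\<^sub>R ((Y o\<^sub>L Y) - (Z o\<^sub>L Z))"
    unfolding root_iter.simps(2) [of B "Suc n"] Y_def [symmetric]
    unfolding Y_def root_iter.simps(2) [of B n] Z_def [symmetric]
    by (simp add: algebra_simps)
  then have "norm (root_iter B (Suc (Suc n)) - root_iter B (Suc n)) \<le> (y\<^sup>2 - z\<^sup>2) / 2"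
    using * by simp
  also have "(y\<^sup>2 - z\<^sup>2) / 2 = majorant (Suc (Suc n)) - majorant (Suc n)"
    unfolding majorant.simps(2) [of "Suc n"] y_def [symmetric]
    unfolding y_def majorant.simps(2) [of n] z_def [symmetric]
    by (simp add: field_simps)
  finally show ?case .
qed

lemma root_iter_fixed_point:
  assumes B: "symmetric_op B" "norm B \<le> 1"
  obtains Y where "symmetric_op Y" "2 *\<^sub>R Y = B + (Y o\<^sub>L Y)"
proof -
  have "summable (\<lambda>n. root_iter B (Suc n) - root_iter B n)"
    using norm_root_iter_increment_le [OF B(2)]
    by (intro summable_comparison_test' [OF summable_majorant_increments, of 0]) blast
  then have "convergent (\<lambda>n. \<Sum>i<n. root_iter B (Suc i) - root_iter B i)"
    by (simp add: summable_iff_convergent)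
  then obtain Y where Y: "root_iter B \<longlonglongrightarrow> Y"
    unfolding sum_lessThan_telescope by (auto simp: convergent_def)
  have "(\<lambda>n. (1/2) *\<^sub>R (B + (root_iter B n o\<^sub>L root_iter B n))) \<longlonglongrightarrow> (1/2) *\<^sub>R (B + (Y o\<^sub>L Y))"
    by (intro tendsto_intros bounded_bilinear.tendsto [OF bounded_bilinear_blinfun_compose] Y)
  moreover have "(\<lambda>n. (1/2) *\<^sub>R (B + (root_iter B n o\<^sub>L root_iter B n))) \<longlonglongrightarrow> Y"
    using LIMSEQ_Suc [OF Y] by simp
  ultimately have "Y = (1/2) *\<^sub>R (B + (Y o\<^sub>L Y))"
    by (rule LIMSEQ_unique [symmetric])
  then have "2 *\<^sub>R Y = 2 *\<^sub>R ((1/2) *\<^sub>R (B + (Y o\<^sub>L Y)))"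
    by (rule arg_cong)
  then have "2 *\<^sub>R Y = B + (Y o\<^sub>L Y)"
    by simp
  with symmetric_op_limit [OF Y symmetric_op_root_iter [OF B(1)]] that show ?thesis
    by blast
qed

text \<open>After rescaling, the form is \<open>\<langle>h, k\<rangle> - \<langle>B h, k\<rangle>\<close> with \<open>0 \<le> B \<le> 1\<close>, and \<open>\<parallel>B\<parallel> \<le> 1\<close> is the
  Cauchy--Schwarz inequality for the form of \<open>B\<close>. The factor \<open>S\<close> is the symmetric operator
  \<open>1 - Y\<close>, up to a scalar.\<close>

lemma positive_form_square_root:
  fixes f :: "'h::complex_hilbert_space \<Rightarrow> 'h \<Rightarrow> complex"
  assumes f: "sesquilinear f" and herm: "\<And>h k. f h k = cnj (f k h)"
    and pos: "\<And>h. 0 \<le> Re (f h h)" and bound: "\<And>h. Re (f h h) \<le> c * (norm h)\<^sup>2"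
  obtains S where "S \<in> bounded_ops" "\<And>h k. f h k = cinner (blinfun_apply S h) (blinfun_apply S k)"
proof -
  \<comment> \<open>A strictly positive bound, so that the form can be divided by it.\<close>
  define e where "e = \<bar>c\<bar> + 1"
  have e: "0 < e" by (simp add: e_def)
  have bound': "Re (f h h) \<le> e * (norm h)\<^sup>2" for h
    using bound [of h] by (rule order_trans) (simp add: e_def mult_right_mono)
  define b where "b h k = cinner h k - f h k / of_real e" for h k
  have b: "sesquilinear b"
    unfolding b_def using sesquilinearD [OF f]
    by (simp add: sesquilinear_def cinner_add_left cinner_add_right cinner_cscale_left
        cinner_cscale_right add_divide_distrib algebra_simps)
  have b_herm: "b h k = cnj (b k h)" for h k
    unfolding b_def by (simp add: cinner_commute [of h k] herm [of h k])
  have b_diag: "Re (b h h) = (norm h)\<^sup>2 - Re (f h h) / e" for h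
    unfolding b_def by (simp add: cinner_self Re_divide_of_real)
  have b_pos: "0 \<le> Re (b h h)" for h
    using bound' [of h] e by (simp add: b_diag field_simps)
  have b_le: "Re (b h h) \<le> (norm h)\<^sup>2" for h
    using pos [of h] e by (simp add: b_diag)
  have b_bound: "cmod (b h k) \<le> 1 * norm h * norm k" for h k
  proof -
    have "(cmod (b h k))\<^sup>2 \<le> Re (b h h) * Re (b k k)"
      by (rule positive_form_Cauchy_Schwarz [OF b b_herm b_pos])
    also have "\<dots> \<le> (norm h * norm k)\<^sup>2"
      unfolding power_mult_distrib by (intro mult_mono b_le b_pos) simp
    finally have "cmod (b h k) \<le> norm h * norm k"
      by (rule power2_le_imp_le) simp
    then show ?thesis by simp
  qed
  obtain B where B: "B \<in> bounded_ops" "norm B \<le> 1" "\<And>h k. b h k = cinner (blinfun_apply B h) k"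
    using bounded_form_representation [OF b zero_le_one b_bound] by blast
  have "cinner (blinfun_apply B h) k = cinner h (blinfun_apply B k)" for h k
    using b_herm [of h k] cinner_commute [of h "blinfun_apply B k"] by (simp add: B(3))
  then have "symmetric_op B"
    using B(1) by (simp add: symmetric_op_def)
  then obtain Y where Y: "symmetric_op Y" "2 *\<^sub>R Y = B + (Y o\<^sub>L Y)"
    using root_iter_fixed_point B(2) by blast
  define T where "T = id_blinfun + (-1) *\<^sub>R Y"
  have T_apply: "blinfun_apply T h = h - blinfun_apply Y h" for h
    by (simp add: T_def blinfun.bilinear_simps)
  have T: "T \<in> bounded_ops"
    using Y(1) unfolding T_def symmetric_op_def
    by (intro bounded_ops_add bounded_ops_id bounded_ops_scaleR) auto
  have TT: "cinner (blinfun_apply T h) (blinfun_apply T k) = f h k / of_real e" for h k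
  proof -
    have sym: "cinner h (blinfun_apply Y k) = cinner (blinfun_apply Y h) k" for h k
      using Y(1) by (simp add: symmetric_op_def)
    have "2 *\<^sub>R blinfun_apply Y h = blinfun_apply B h + blinfun_apply Y (blinfun_apply Y h)"
      using arg_cong [OF Y(2), of "\<lambda>T. blinfun_apply T h"] by (simp add: blinfun.bilinear_simps)
    then have "2 * cinner (blinfun_apply Y h) k
        = b h k + cinner (blinfun_apply Y (blinfun_apply Y h)) k"
      using cinner_scaleR_left [of 2 "blinfun_apply Y h" k] by (simp add: cinner_add_left B(3))
    moreover have "cinner (blinfun_apply T h) (blinfun_apply T k) = cinner h k
        - 2 * cinner (blinfun_apply Y h) k + cinner (blinfun_apply Y (blinfun_apply Y h)) k"
      by (simp add: T_apply blinfun.diff_right cinner_diff_left cinner_diff_right sym)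
    ultimately show ?thesis
      by (simp add: b_def)
  qed
  show ?thesis
  proof (rule that [of "sqrt e *\<^sub>R T"])
    show "sqrt e *\<^sub>R T \<in> bounded_ops"
      by (rule bounded_ops_scaleR [OF T])
    have "complex_of_real (sqrt e) * complex_of_real (sqrt e) = of_real e"
      using e by (simp flip: of_real_mult)
    then show "f h k = cinner (blinfun_apply (sqrt e *\<^sub>R T) h) (blinfun_apply (sqrt e *\<^sub>R T) k)" for h k
      using e by (simp add: blinfun.bilinear_simps cinner_scaleR_left cinner_scaleR_right TT
          flip: mult.assoc)
  qed
qed


section \<open>Positive kernels of forms\<close>

text \<open>A positive block matrix \<open>(A\<^sub>u\<^sub>v)\<close> of operators, written through the forms
  \<open>G u v h k = \<langle>A\<^sub>u\<^sub>v h, k\<rangle>\<close>. The conditions are the purely algebraic ones, which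
  pointwise limits inherit; bounds on a kernel are stated separately where they are known.\<close>

definition psd_kernel :: "'i set \<Rightarrow> ('i \<Rightarrow> 'i \<Rightarrow> 'h::complex_hilbert_space \<Rightarrow> 'h \<Rightarrow> complex) \<Rightarrow> bool" where
  "psd_kernel W G \<longleftrightarrow>
     (\<forall>u\<in>W. \<forall>v\<in>W. sesquilinear (G u v)) \<and>
     (\<forall>u\<in>W. \<forall>v\<in>W. \<forall>h k. G u v h k = cnj (G v u k h)) \<and>
     (\<forall>x. 0 \<le> Re (\<Sum>u\<in>W. \<Sum>v\<in>W. G u v (x v) (x u)))"

lemma psd_kernelD:
  assumes "psd_kernel W G"
  shows "u \<in> W \<Longrightarrow> v \<in> W \<Longrightarrow> sesquilinear (G u v)"
    and "u \<in> W \<Longrightarrow> v \<in> W \<Longrightarrow> G u v h k = cnj (G v u k h)"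
    and "0 \<le> Re (\<Sum>u\<in>W. \<Sum>v\<in>W. G u v (x v) (x u))"
  using assms unfolding psd_kernel_def by blast+

lemma kernel_sum_single:
  assumes "finite W" "u \<in> W" "v \<in> W" and "\<And>a b. a \<in> W \<Longrightarrow> b \<in> W \<Longrightarrow> sesquilinear (G a b)"
  shows "(\<Sum>a\<in>W. \<Sum>b\<in>W. G a b (if b = v then h else 0) (if a = u then k else 0)) = G u v h k"
proof -
  have "(\<Sum>a\<in>W. \<Sum>b\<in>W. G a b (if b = v then h else 0) (if a = u then k else 0))
      = (\<Sum>a\<in>W. if a = u then (\<Sum>b\<in>W. if b = v then G u v h k else 0) else 0)"
    by (intro sum.cong refl) (auto intro!: sum.cong sum.neutral simp: sesquilinearD [OF assms(4)])
  also have "\<dots> = G u v h k"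
    using assms(1-3) by simp
  finally show ?thesis .
qed

lemma psd_kernel_diag_nonneg:
  assumes G: "psd_kernel W G" and W: "finite W" and w: "w \<in> W"
  shows "0 \<le> Re (G w w k k)"
  using psd_kernelD(3) [OF G, of "\<lambda>a. if a = w then k else 0"]
  by (simp add: kernel_sum_single W w psd_kernelD(1) [OF G])

text \<open>Positivity is tested on the vector with entries \<open>h\<close> at \<open>v\<close> and \<open>c k\<close> at \<open>u\<close>. Writing it as a sum
  of two one-entry vectors covers the case \<open>u = v\<close> as well.\<close>

lemma psd_kernel_Cauchy_Schwarz:
  assumes G: "psd_kernel W G" and W: "finite W" and u: "u \<in> W" and v: "v \<in> W"
  shows "(cmod (G u v h k))\<^sup>2 \<le> Re (G v v h h) * Re (G u u k k)"
proof -
  note sesq = psd_kernelD(1) [OF G]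
  have "(cmod (G v u k h))\<^sup>2 \<le> Re (G v v h h) * Re (G u u k k)"
  proof (rule cmod_square_le_of_nonneg_quadratic)
    fix c
    let ?p = "\<lambda>a. if a = v then h else 0" and ?q = "\<lambda>a. if a = u then cscale c k else 0"
    have "(\<Sum>a\<in>W. \<Sum>b\<in>W. G a b (?p b + ?q b) (?p a + ?q a))
        = (\<Sum>a\<in>W. \<Sum>b\<in>W. G a b (?p b) (?p a) + G a b (?q b) (?p a)
            + G a b (?p b) (?q a) + G a b (?q b) (?q a))"
      by (intro sum.cong refl) (simp only: sesquilinearD(1,3) [OF sesq] ac_simps)
    also have "\<dots> = G v v h h + G v u (cscale c k) h + G u v h (cscale c k)
        + G u u (cscale c k) (cscale c k)"
      by (simp only: sum.distrib kernel_sum_single [OF W] u v sesq)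
    also have "\<dots> = G v v h h + c * G v u k h + cnj (c * G v u k h) + (c * cnj c) * G u u k k"
      by (simp add: sesquilinearD(2,4) [OF sesq] u v psd_kernelD(2) [OF G u v])
    finally have "0 \<le> Re (G v v h h + c * G v u k h + cnj (c * G v u k h) + (c * cnj c) * G u u k k)"
      using psd_kernelD(3) [OF G, of "\<lambda>a. ?p a + ?q a"] by simp
    also have "\<dots> = Re (G v v h h) + 2 * Re (c * G v u k h) + (cmod c)\<^sup>2 * Re (G u u k k)"
      by (rule Re_polarization)
    finally show "0 \<le> Re (G v v h h) + 2 * Re (c * G v u k h) + (cmod c)\<^sup>2 * Re (G u u k k)" .
  qed (rule psd_kernel_diag_nonneg [OF G W u])
  then show ?thesis
    by (simp add: psd_kernelD(2) [OF G u v])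
qed

text \<open>Eliminating the index \<open>u0\<close> as in the Cholesky algorithm: once \<open>G u0 u0\<close> is written with an
  operator \<open>S\<close> and the other entries of its row with operators \<open>X v\<close> into the closed range of
  \<open>S\<close>, the remaining Schur complement is positive, because the vector at \<open>u0\<close> can be chosen
  to make the contribution of the eliminated square arbitrarily small.\<close>

lemma psd_kernel_Schur_complement:
  assumes G: "psd_kernel (insert u0 W) G" and W: "finite W" "u0 \<notin> W"
    and S: "S \<in> bounded_ops" "\<And>h k. G u0 u0 h k = cinner (blinfun_apply S h) (blinfun_apply S k)"
    and X: "\<And>v. v \<in> W \<Longrightarrow> X v \<in> bounded_ops"
      "\<And>v h. v \<in> W \<Longrightarrow> blinfun_apply (X v) h \<in> closure (range (blinfun_apply S))"
      "\<And>v h k. v \<in> W \<Longrightarrow> G u0 v h k = cinner (blinfun_apply (X v) h) (blinfun_apply S k)"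
  shows "psd_kernel W (\<lambda>u v h k. G u v h k - cinner (blinfun_apply (X v) h) (blinfun_apply (X u) k))"
  unfolding psd_kernel_def
proof (intro conjI ballI allI)
  fix u v assume u: "u \<in> W" and v: "v \<in> W"
  show "sesquilinear (\<lambda>h k. G u v h k - cinner (blinfun_apply (X v) h) (blinfun_apply (X u) k))"
    using u v by (intro sesquilinear_diff sesquilinear_cinner psd_kernelD(1) [OF G]
        bounded_ops_clinear X(1)) auto
  fix h k
  show "G u v h k - cinner (blinfun_apply (X v) h) (blinfun_apply (X u) k)
      = cnj (G v u k h - cinner (blinfun_apply (X u) k) (blinfun_apply (X v) h))"
    using psd_kernelD(2) [OF G, of u v h k] u v
      cinner_commute [of "blinfun_apply (X v) h" "blinfun_apply (X u) k"] by simp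
next
  fix x :: "'a \<Rightarrow> 'b"
  define y where "y = (\<Sum>v\<in>W. blinfun_apply (X v) (x v))"
  define A where "A = (\<Sum>u\<in>W. \<Sum>v\<in>W. G u v (x v) (x u))"
  note S_lin = bounded_ops_clinear [OF S(1)]
  have nonneg: "0 \<le> Re A - (norm y)\<^sup>2 + (norm (y + blinfun_apply S k))\<^sup>2" for k
  proof -
    let ?x = "x(u0 := k)"
    have x: "?x v = x v" if "v \<in> W" for v
      using that W(2) by auto
    have col: "G u u0 k (x u) = cnj (cinner (blinfun_apply (X u) (x u)) (blinfun_apply S k))"
      if "u \<in> W" for u
      using psd_kernelD(2) [OF G, of u u0] X(3) that by simp
    have "(\<Sum>u\<in>insert u0 W. \<Sum>v\<in>insert u0 W. G u v (?x v) (?x u))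
        = G u0 u0 k k + (\<Sum>v\<in>W. G u0 v (x v) k) + ((\<Sum>u\<in>W. G u u0 k (x u)) + A)"
      using W by (simp add: x sum.distrib A_def del: fun_upd_apply add: fun_upd_same)
    also have "\<dots> = of_real ((norm (blinfun_apply S k))\<^sup>2) + cinner y (blinfun_apply S k)
        + (cnj (cinner y (blinfun_apply S k)) + A)"
      unfolding y_def cinner_sum_left cnj_sum by (simp add: S(2) cinner_self X(3) col)
    finally have "0 \<le> Re (of_real ((norm (blinfun_apply S k))\<^sup>2) + cinner y (blinfun_apply S k)
        + (cnj (cinner y (blinfun_apply S k)) + A))"
      using psd_kernelD(3) [OF G, of ?x] by simp
    then show ?thesis
      by (simp add: norm_add_square)
  qed
  have "y \<in> closure (range (blinfun_apply S))"
    unfolding y_def by (intro closure_range_sum S_lin X(2))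
  \<comment> \<open>Let \<open>S k\<close> approach \<open>- y\<close>: the last square in \<open>nonneg\<close> disappears in the limit.\<close>
  then have "cscale (-1) y \<in> closure (range (blinfun_apply S))"
    by (rule closure_range_cscale [OF S_lin])
  then have "- y \<in> closure (range (blinfun_apply S))"
    using cscale_of_real [of "-1" y] by simp
  then obtain a where a: "\<And>n. a n \<in> range (blinfun_apply S)" "a \<longlonglongrightarrow> - y"
    unfolding closure_sequential by metis
  have "(\<lambda>n. Re A - (norm y)\<^sup>2 + (norm (y + a n))\<^sup>2) \<longlonglongrightarrow> Re A - (norm y)\<^sup>2 + (norm (y + - y))\<^sup>2"
    by (intro tendsto_intros a)
  moreover have "0 \<le> Re A - (norm y)\<^sup>2 + (norm (y + a n))\<^sup>2" for n
    using a(1) [of n] nonneg by auto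
  ultimately have "0 \<le> Re A - (norm y)\<^sup>2 + (norm (y + - y))\<^sup>2"
    by (intro LIMSEQ_le_const) auto
  moreover have yy: "cinner y y
      = (\<Sum>u\<in>W. \<Sum>v\<in>W. cinner (blinfun_apply (X v) (x v)) (blinfun_apply (X u) (x u)))"
    unfolding y_def cinner_sum_right by (simp only: cinner_sum_left)
  ultimately show "0 \<le> Re (\<Sum>u\<in>W. \<Sum>v\<in>W. G u v (x v) (x u)
      - cinner (blinfun_apply (X v) (x v)) (blinfun_apply (X u) (x u)))"
    unfolding sum_subtractf A_def [symmetric] by (simp add: Re_cinner_self flip: yy)
qed

text \<open>Every bounded positive kernel is a Gram kernel with as many factors as indices: this is the
  Cholesky factorization, by induction on the index set. The pivot is taken apart by a square root,
  its row by \<open>form_representation\<close>, whose hypothesis is the Cauchy--Schwarz inequality of the kernel,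
  and the induction hypothesis applies to the Schur complement.\<close>

lemma psd_kernel_factorization:
  fixes G :: "'i \<Rightarrow> 'i \<Rightarrow> 'h::complex_hilbert_space \<Rightarrow> 'h \<Rightarrow> complex"
  assumes "finite W" "psd_kernel W G" "0 \<le> c" "\<And>u h. u \<in> W \<Longrightarrow> Re (G u u h h) \<le> c * (norm h)\<^sup>2"
  shows "\<exists>R. (\<forall>i\<in>W. \<forall>u\<in>W. R i u \<in> bounded_ops) \<and>
    (\<forall>u\<in>W. \<forall>v\<in>W. \<forall>h k.
      G u v h k = (\<Sum>i\<in>W. cinner (blinfun_apply (R i v) h) (blinfun_apply (R i u) k)))"
  using assms
proof (induction W arbitrary: G rule: finite_induct)
  case (insert u0 W)
  note G = insert.prems(1) and c = insert.prems(2) and bound = insert.prems(3)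
  have fin: "finite (insert u0 W)" using insert.hyps by simp
  note diag = psd_kernel_diag_nonneg [OF G fin]
  obtain S where S: "S \<in> bounded_ops"
      "\<And>h k. G u0 u0 h k = cinner (blinfun_apply S h) (blinfun_apply S k)"
    by (rule positive_form_square_root [of "G u0 u0" c])
      (auto intro: psd_kernelD(1) [OF G] psd_kernelD(2) [OF G] diag bound)
  have "\<exists>Xv. Xv \<in> bounded_ops \<and> (\<forall>h. blinfun_apply Xv h \<in> closure (range (blinfun_apply S)))
      \<and> (\<forall>h k. G u0 v h k = cinner (blinfun_apply Xv h) (blinfun_apply S k))" if v: "v \<in> W" for v
  proof -
    have "cmod (G u0 v h k) \<le> sqrt c * norm h * norm (blinfun_apply S k)" for h k
    proof -
      have "(cmod (G u0 v h k))\<^sup>2 \<le> Re (G v v h h) * Re (G u0 u0 k k)"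
        by (rule psd_kernel_Cauchy_Schwarz [OF G fin]) (use v in auto)
      also have "\<dots> \<le> (c * (norm h)\<^sup>2) * (norm (blinfun_apply S k))\<^sup>2"
        unfolding S(2) Re_cinner_self using bound v by (intro mult_right_mono) auto
      also have "\<dots> = (sqrt c * norm h * norm (blinfun_apply S k))\<^sup>2"
        using c by (simp add: power_mult_distrib)
      finally show ?thesis
        by (rule power2_le_imp_le) (use c in simp)
    qed
    then obtain Xv where "Xv \<in> bounded_ops" "\<And>h. blinfun_apply Xv h \<in> closure (range (blinfun_apply S))"
      "\<And>h k. G u0 v h k = cinner (blinfun_apply Xv h) (blinfun_apply S k)"
      using form_representation [OF bounded_ops_clinear [OF S(1)] _ real_sqrt_ge_zero [OF c]]
        psd_kernelD(1) [OF G, of u0 v] v by (metis insertCI)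
    then show ?thesis by blast
  qed
  then obtain X where X: "\<And>v. v \<in> W \<Longrightarrow> X v \<in> bounded_ops"
      "\<And>v h. v \<in> W \<Longrightarrow> blinfun_apply (X v) h \<in> closure (range (blinfun_apply S))"
      "\<And>v h k. v \<in> W \<Longrightarrow> G u0 v h k = cinner (blinfun_apply (X v) h) (blinfun_apply S k)"
    by metis
  define G' where "G' u v h k = G u v h k - cinner (blinfun_apply (X v) h) (blinfun_apply (X u) k)"
    for u v h k
  have G': "psd_kernel W G'"
    unfolding G'_def by (rule psd_kernel_Schur_complement [OF G insert.hyps S X])
  have bound': "Re (G' u u h h) \<le> c * (norm h)\<^sup>2" if "u \<in> W" for u h
    unfolding G'_def minus_complex.sel Re_cinner_self
    using bound [of u h] that by (simp add: add_increasing2 diff_le_eq)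
  obtain R where R: "\<And>i u. i \<in> W \<Longrightarrow> u \<in> W \<Longrightarrow> R i u \<in> bounded_ops"
      "\<And>u v h k. u \<in> W \<Longrightarrow> v \<in> W \<Longrightarrow>
        G' u v h k = (\<Sum>i\<in>W. cinner (blinfun_apply (R i v) h) (blinfun_apply (R i u) k))"
    using insert.IH [OF G' c bound'] by blast
  define R' where "R' i u = (if i = u0 then if u = u0 then S else X u
      else if u = u0 then 0 else R i u)" for i u
  have off: "i \<noteq> u0" if "i \<in> W" for i
    using that insert.hyps(2) by auto
  show ?case
  proof (intro exI [of _ R'] conjI ballI allI)
    show "R' i u \<in> bounded_ops" if "i \<in> insert u0 W" "u \<in> insert u0 W" for i u
      using that S(1) X(1) R(1) by (auto simp: R'_def bounded_ops_zero)
    fix u v h k assume u: "u \<in> insert u0 W" and v: "v \<in> insert u0 W"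
    have split: "(\<Sum>i\<in>insert u0 W. cinner (blinfun_apply (R' i v) h) (blinfun_apply (R' i u) k))
        = cinner (blinfun_apply (R' u0 v) h) (blinfun_apply (R' u0 u) k)
          + (if u = u0 \<or> v = u0 then 0
             else \<Sum>i\<in>W. cinner (blinfun_apply (R i v) h) (blinfun_apply (R i u) k))"
      using insert.hyps by (auto simp: R'_def off intro!: sum.cong sum.neutral)
    have "G u u0 h k = cinner (blinfun_apply S h) (blinfun_apply (X u) k)" if "u \<in> W"
      using psd_kernelD(2) [OF G, of u u0 h k] that X(3) [OF that, of k h]
        cinner_commute [of "blinfun_apply S h" "blinfun_apply (X u) k"] by simp
    moreover have "G u v h k = cinner (blinfun_apply (X v) h) (blinfun_apply (X u) k)
        + (\<Sum>i\<in>W. cinner (blinfun_apply (R i v) h) (blinfun_apply (R i u) k))"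
      if "u \<in> W" "v \<in> W"
      using R(2) [OF that, of h k] by (simp add: G'_def algebra_simps)
    ultimately show "G u v h k
        = (\<Sum>i\<in>insert u0 W. cinner (blinfun_apply (R' i v) h) (blinfun_apply (R' i u) k))"
      unfolding split using u v by (auto simp: R'_def S(2) X(3) off)
  qed
qed simp


section \<open>Coefficients of sums of squares\<close>

text \<open>Since \<open>u\<^sup>* v\<close> is the word \<open>rev u @ v\<close>, these are the pairs of words that contribute to the
  coefficient at \<open>w\<close> of a sum \<open>\<Sum>\<^sub>u\<^sub>v A\<^sub>u\<^sub>v u\<^sup>* v\<close>.\<close>

definition hankel_pairs :: "nat list set \<Rightarrow> nat list \<Rightarrow> (nat list \<times> nat list) set" where
  "hankel_pairs W w = {(u, v) \<in> W \<times> W. rev u @ v = w}"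

lemma finite_words: "finite (words g d)"
  unfolding words_def using finite_lists_length_le [of "{..<g}" d] by simp

lemma finite_splits: "finite {(u, v). u @ v = w}"
proof (rule finite_subset)
  show "{(u, v). u @ v = w} \<subseteq> (\<lambda>n. (take n w, drop n w)) ` {..length w}"
  proof clarify
    fix u v :: "'a list"
    show "(u, v) \<in> (\<lambda>n. (take n (u @ v), drop n (u @ v))) ` {..length (u @ v)}"
      by (rule image_eqI [of _ _ "length u"]) simp_all
  qed
qed simp

lemma ncpolys_degD:
  assumes "p \<in> ncpolys_deg g d"
  shows "p w \<in> bounded_ops" "w \<notin> words g d \<Longrightarrow> p w = 0"
  using assms by (auto simp: ncpolys_deg_def ncpolys_def words_def)

lemma ncpolys_degI:
  assumes "\<And>w. p w \<in> bounded_ops" and "\<And>w. w \<notin> words g d \<Longrightarrow> p w = 0"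
  shows "p \<in> ncpolys_deg g d"
proof -
  have "{w. p w \<noteq> 0} \<subseteq> words g d"
    using assms(2) by blast
  moreover from this have "finite {w. p w \<noteq> 0}"
    by (rule finite_subset) (rule finite_words)
  ultimately show ?thesis
    using assms(1) by (auto simp: ncpolys_deg_def ncpolys_def words_def)
qed

lemma cinner_nc_square:
  assumes r: "r \<in> ncpolys_deg g d"
  shows "cinner (blinfun_apply (nc_mult (nc_adj r) r w) h) k
    = (\<Sum>(u, v)\<in>hankel_pairs (words g d) w. cinner (blinfun_apply (r v) h) (blinfun_apply (r u) k))"
proof -
  let ?t = "\<lambda>(u, v). cinner (blinfun_apply (r v) h) (blinfun_apply (r u) k)"
  have "cinner (blinfun_apply (nc_mult (nc_adj r) r w) h) k
      = (\<Sum>(a, b)\<in>{(a, b). a @ b = w}. ?t (rev a, b))"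
    unfolding nc_mult_def nc_adj_def
    by (simp add: blinfun.sum_left cinner_sum_left case_prod_unfold op_adj ncpolys_degD(1) [OF r])
  also have "\<dots> = sum ?t {(u, v). rev u @ v = w}"
    by (rule sum.reindex_bij_witness [of _ "\<lambda>(u, v). (rev u, v)" "\<lambda>(u, v). (rev u, v)"]) auto
  also have "\<dots> = sum ?t (hankel_pairs (words g d) w)"
  proof (rule sum.mono_neutral_right)
    have "{(u, v). rev u @ v = w} = (\<lambda>(u, v). (rev u, v)) ` {(u, v). u @ v = w}"
      by (force simp: image_iff)
    then show "finite {(u, v). rev u @ v = w}"
      by (simp add: finite_splits)
    show "\<forall>x\<in>{(u, v). rev u @ v = w} - hankel_pairs (words g d) w. ?t x = 0"
      using ncpolys_degD(2) [OF r] by (fastforce simp: hankel_pairs_def)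
  qed (auto simp: hankel_pairs_def)
  finally show ?thesis .
qed

definition gram :: "'i set \<Rightarrow> ('i \<Rightarrow> 'j \<Rightarrow> ('h::complex_hilbert_space \<Rightarrow>\<^sub>L 'h)) \<Rightarrow> 'j \<Rightarrow> 'j \<Rightarrow> 'h \<Rightarrow> 'h \<Rightarrow> complex" where
  "gram I R u v h k = (\<Sum>i\<in>I. cinner (blinfun_apply (R i v) h) (blinfun_apply (R i u) k))"

lemma cinner_sum_nc_squares:
  assumes "\<And>i. i \<in> I \<Longrightarrow> r i \<in> ncpolys_deg g d"
  shows "cinner (blinfun_apply (\<Sum>i\<in>I. nc_mult (nc_adj (r i)) (r i) w) h) k
    = (\<Sum>(u, v)\<in>hankel_pairs (words g d) w. gram I r u v h k)"
proof -
  have "cinner (blinfun_apply (\<Sum>i\<in>I. nc_mult (nc_adj (r i)) (r i) w) h) k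
      = (\<Sum>i\<in>I. \<Sum>(u, v)\<in>hankel_pairs (words g d) w.
          cinner (blinfun_apply (r i v) h) (blinfun_apply (r i u) k))"
    unfolding blinfun.sum_left cinner_sum_left
    by (intro sum.cong refl cinner_nc_square assms)
  also have "\<dots> = (\<Sum>(u, v)\<in>hankel_pairs (words g d) w. gram I r u v h k)"
    unfolding gram_def case_prod_unfold by (rule sum.swap)
  finally show ?thesis .
qed

lemma sesquilinear_sum:
  "(\<And>i. i \<in> I \<Longrightarrow> sesquilinear (f i)) \<Longrightarrow> sesquilinear (\<lambda>h k. \<Sum>i\<in>I. f i h k)"
  by (simp add: sesquilinear_def sum.distrib sum_distrib_left)

lemma psd_kernel_gram:
  assumes R: "\<And>i u. i \<in> I \<Longrightarrow> u \<in> W \<Longrightarrow> R i u \<in> bounded_ops"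
  shows "psd_kernel W (gram I R)"
  unfolding psd_kernel_def
proof (intro conjI ballI allI)
  fix u v assume "u \<in> W" "v \<in> W"
  then show "sesquilinear (gram I R u v)"
    unfolding gram_def [abs_def]
    by (intro sesquilinear_sum sesquilinear_cinner bounded_ops_clinear R)
  show "gram I R u v h k = cnj (gram I R v u k h)" for h k
    unfolding gram_def cnj_sum by (intro sum.cong refl cinner_commute)
next
  fix x
  define y where "y i = (\<Sum>u\<in>W. blinfun_apply (R i u) (x u))" for i
  let ?t = "\<lambda>i u v. cinner (blinfun_apply (R i v) (x v)) (blinfun_apply (R i u) (x u))"
  have "(\<Sum>u\<in>W. \<Sum>v\<in>W. gram I R u v (x v) (x u)) = (\<Sum>u\<in>W. \<Sum>i\<in>I. \<Sum>v\<in>W. ?t i u v)"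
    unfolding gram_def by (intro sum.cong refl sum.swap)
  also have "\<dots> = (\<Sum>i\<in>I. \<Sum>u\<in>W. \<Sum>v\<in>W. ?t i u v)"
    by (rule sum.swap)
  also have "\<dots> = (\<Sum>i\<in>I. cinner (y i) (y i))"
    unfolding y_def cinner_sum_right by (simp only: cinner_sum_left)
  finally have "(\<Sum>u\<in>W. \<Sum>v\<in>W. gram I R u v (x v) (x u)) = (\<Sum>i\<in>I. cinner (y i) (y i))" .
  then show "0 \<le> Re (\<Sum>u\<in>W. \<Sum>v\<in>W. gram I R u v (x v) (x u))"
    by (simp add: Re_cinner_self sum_nonneg)
qed

lemma hankel_pairs_words_degree:
  assumes "2 * d \<le> D" "w \<notin> words g D"
  shows "hankel_pairs (words g d) w = {}"
  using assms by (auto simp: hankel_pairs_def words_def)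

lemma sos_cone_subset_ncpolys_deg:
  assumes "2 * d \<le> D"
  shows "sos_cone g d \<subseteq> (ncpolys_deg g D :: 'h::complex_hilbert_space ncpoly set)"
proof
  fix p :: "'h ncpoly" assume "p \<in> sos_cone g d"
  then obtain r where r: "\<And>i. i \<in> {1..num_words g d} \<Longrightarrow> r i \<in> ncpolys_deg g d"
    and p: "p = (\<lambda>w. \<Sum>i=1..num_words g d. nc_mult (nc_adj (r i)) (r i) w)"
    unfolding sos_cone_def by blast
  show "p \<in> ncpolys_deg g D"
  proof (rule ncpolys_degI)
    show "p w \<in> bounded_ops" for w
      unfolding p nc_mult_def nc_adj_def case_prod_unfold
      by (intro bounded_ops_sum bounded_ops_compose op_adj ncpolys_degD(1) [OF r])
    show "p w = 0" if "w \<notin> words g D" for w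
    proof (rule blinfun_eqI, rule cinner_eqI)
      fix h k
      have "cinner (blinfun_apply (p w) h) k = (\<Sum>(u, v)\<in>hankel_pairs (words g d) w.
          gram {1..num_words g d} r u v h k)"
        unfolding p by (rule cinner_sum_nc_squares) (rule r)
      then show "cinner (blinfun_apply (p w) h) k = cinner (blinfun_apply 0 h) k"
        by (simp add: hankel_pairs_words_degree [OF assms that])
    qed
  qed
qed


section \<open>Coefficients control the diagonal of the kernel\<close>

text \<open>A positive functional that is definite on squares: it vanishes off the words \<open>u\<^sup>* u\<close>, which it sends
  to the weight of \<open>u\<close>. Its moment matrix has the weights on the diagonal. An entry off the diagonal
  is nonzero only for words \<open>u\<close>, \<open>v\<close> of different lengths \<open>a\<close>, \<open>b\<close> of equal parity, and then equals
  the weight of a word of length \<open>(a + b) / 2\<close>. For weights \<open>K\<^bsup>n\<^sup>2\<^esup>\<close> this is at most \<open>1 / K\<close> times the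
  geometric mean of the two diagonal entries, so \<open>K = 2 N\<close> makes a matrix of size \<open>N\<close> diagonally
  dominant after rescaling.\<close>

definition weight :: "nat list set \<Rightarrow> nat list \<Rightarrow> real" where
  "weight W u = (2 * real (card W)) ^ (length u)\<^sup>2"

lemma rev_append_self_eq_iff [simp]: "rev s @ s = rev t @ t \<longleftrightarrow> s = t"
proof
  assume eq: "rev s @ s = rev t @ t"
  from arg_cong [OF eq, of length] have "length (rev s) = length (rev t)" by simp
  with eq show "s = t" by simp
qed simp

lemma square_mean_le:
  fixes a b m :: nat
  assumes "a \<noteq> b" "a + b = 2 * m"
  shows "2 * m\<^sup>2 + 2 \<le> a\<^sup>2 + b\<^sup>2"
proof -
  define e where "e = int a - int m"
  have a: "int a = int m + e" and b: "int b = int m - e" and "e \<noteq> 0"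
    using assms by (auto simp: e_def)
  then have "1 \<le> e\<^sup>2"
    by (simp add: int_one_le_iff_zero_less)
  then have "2 * (int m)\<^sup>2 + 2 \<le> (int a)\<^sup>2 + (int b)\<^sup>2"
    unfolding a b by (simp add: power2_eq_square algebra_simps)
  then have "int (2 * m\<^sup>2 + 2) \<le> int (a\<^sup>2 + b\<^sup>2)"
    by simp
  then show ?thesis
    by (simp only: zle_int)
qed

text \<open>The entry \<open>G u v\<close> is at most the geometric mean of the diagonal entries, and the weight of \<open>s\<close> is
  at most \<open>1 / (2 N)\<close> times that of the weights of \<open>u\<close> and \<open>v\<close>, with \<open>N = card W\<close>. Passing
  to the arithmetic mean of the weighted diagonal entries gives the other factor \<open>1 / 2\<close>.\<close>

lemma off_diagonal_pair_le:
  assumes G: "psd_kernel W G" and W: "finite W" and u: "u \<in> W" and v: "v \<in> W" and "u \<noteq> v"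
    and s: "rev s @ s = rev u @ v"
  shows "weight W s * cmod (G u v h h)
    \<le> (weight W u * Re (G u u h h) + weight W v * Re (G v v h h)) / (4 * real (card W))"
proof -
  define K where "K = 2 * real (card W)"
  have "card W \<noteq> 0" using W u by auto
  then have K: "1 \<le> K" unfolding K_def by simp
  define a b where "a = weight W u * Re (G u u h h)" and "b = weight W v * Re (G v v h h)"
  have wK: "weight W w = K ^ (length w)\<^sup>2" for w
    by (simp add: weight_def K_def)
  have w0: "0 \<le> weight W w" for w
    using K by (simp add: wK)
  have len: "length u + length v = 2 * length s"
    using arg_cong [OF s, of length] by simp
  have "length u \<noteq> length v"
  proof
    assume "length u = length v"
    with len have "length (rev s) = length (rev u)" by simp
    with s have "rev s = rev u" "s = v" by auto
    with \<open>u \<noteq> v\<close> show False by auto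
  qed
  with len have "2 * (length s)\<^sup>2 + 2 \<le> (length u)\<^sup>2 + (length v)\<^sup>2"
    by (intro square_mean_le)
  then have "K ^ (2 * (length s)\<^sup>2 + 2) \<le> K ^ ((length u)\<^sup>2 + (length v)\<^sup>2)"
    using K by (rule power_increasing)
  then have ww: "(K * weight W s)\<^sup>2 \<le> weight W u * weight W v"
    by (simp only: wK power_mult_distrib power_add power_mult [symmetric] ac_simps)
  have "(K * weight W s * cmod (G u v h h))\<^sup>2
      \<le> (weight W u * weight W v) * (Re (G v v h h) * Re (G u u h h))"
    unfolding power_mult_distrib [of "K * weight W s"]
    using w0 by (intro mult_mono ww psd_kernel_Cauchy_Schwarz [OF G W u v]) auto
  also have "\<dots> = a * b"
    by (simp add: a_def b_def)
  also have "\<dots> \<le> ((a + b) / 2)\<^sup>2"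
    using zero_le_power2 [of "a - b"] by (simp add: power2_eq_square field_simps)
  finally have "K * weight W s * cmod (G u v h h) \<le> (a + b) / 2"
    by (rule power2_le_imp_le)
      (simp add: a_def b_def w0 psd_kernel_diag_nonneg [OF G W] u v)
  then show ?thesis
    using K unfolding a_def b_def K_def by (simp add: field_simps)
qed

text \<open>Finitely many coefficients of a sum of squares control the diagonal of its kernel: applying the
  functional of the weights to \<open>\<Sum>\<^sub>u\<^sub>v G\<^sub>u\<^sub>v u\<^sup>* v\<close> yields the weighted diagonal, up to off-diagonal terms that eat up at most half of it.\<close>

lemma weighted_diagonal_le:
  assumes G: "psd_kernel W G" and W: "finite W"
  shows "(\<Sum>u\<in>W. weight W u * Re (G u u h h))
    \<le> 2 * (\<Sum>s\<in>W. weight W s * Re (\<Sum>(u, v)\<in>hankel_pairs W (rev s @ s). G u v h h))"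
proof (cases "W = {}")
  case False
  with W have N: "0 < real (card W)" by (simp add: card_gt_0_iff)
  define a where "a u = weight W u * Re (G u u h h)" for u
  define T where "T = (\<Sum>u\<in>W. a u)"
  \<comment> \<open>The moment matrix; at most one \<open>s\<close> contributes to each entry.\<close>
  define m where "m u v = (\<Sum>s | s \<in> W \<and> rev s @ s = rev u @ v. weight W s)" for u v
  have a0: "0 \<le> a u" if "u \<in> W" for u
    unfolding a_def weight_def by (simp add: psd_kernel_diag_nonneg [OF G W that])
  have m: "(if u = v then a u else 0) - (a u + a v) / (4 * real (card W)) \<le> m u v * Re (G u v h h)"
    if u: "u \<in> W" and v: "v \<in> W" for u v
  proof (cases "u = v")
    case True
    have "{s. s \<in> W \<and> rev s @ s = rev u @ u} = {u}"
      using u by auto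
    then have "m u v * Re (G u v h h) = a u"
      using True by (simp add: m_def a_def)
    then show ?thesis
      using True a0 [OF u] by simp
  next
    case uv: False
    show ?thesis
    proof (cases "\<exists>s\<in>W. rev s @ s = rev u @ v")
      case True
      then obtain s where s: "s \<in> W" "rev s @ s = rev u @ v" by blast
      then have "{s. s \<in> W \<and> rev s @ s = rev u @ v} = {s}"
        by (auto simp flip: s(2))
      then have "m u v = weight W s"
        by (simp add: m_def)
      moreover have "weight W s * cmod (G u v h h) \<le> (a u + a v) / (4 * real (card W))"
        unfolding a_def by (rule off_diagonal_pair_le [OF G W u v uv s(2)])
      moreover have "- (weight W s * cmod (G u v h h)) \<le> weight W s * Re (G u v h h)"
        using abs_Re_le_cmod [of "G u v h h"] mult_left_mono [of "- cmod (G u v h h)" "Re (G u v h h)" "weight W s"]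
        by (simp add: weight_def)
      ultimately show ?thesis
        using uv by simp
    next
      case False
      then have "{s. s \<in> W \<and> rev s @ s = rev u @ v} = {}" by blast
      then have "m u v = 0" by (simp only: m_def sum.empty)
      then show ?thesis
        using uv a0 [OF u] a0 [OF v] by simp
    qed
  qed
  have "T / 2 = (\<Sum>u\<in>W. \<Sum>v\<in>W. (if u = v then a u else 0) - (a u + a v) / (4 * real (card W)))"
    using N W by (simp add: sum_subtractf sum.distrib T_def add_divide_distrib
        flip: sum_divide_distrib sum_distrib_left)
  also have "\<dots> \<le> (\<Sum>u\<in>W. \<Sum>v\<in>W. m u v * Re (G u v h h))"
    by (intro sum_mono m)
  also have "\<dots> = (\<Sum>(u, v)\<in>W \<times> W. \<Sum>s\<in>W. if rev s @ s = rev u @ v then weight W s * Re (G u v h h) else 0)"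
    unfolding sum.cartesian_product [symmetric] m_def sum_distrib_right sum.inter_filter [OF W]
    by (intro sum.cong refl) simp
  also have "\<dots> = (\<Sum>s\<in>W. \<Sum>(u, v)\<in>W \<times> W. if rev s @ s = rev u @ v then weight W s * Re (G u v h h) else 0)"
    unfolding case_prod_unfold by (rule sum.swap)
  also have "\<dots> = (\<Sum>s\<in>W. weight W s * Re (\<Sum>(u, v)\<in>hankel_pairs W (rev s @ s). G u v h h))"
  proof (rule sum.cong [OF refl])
    fix s
    have "hankel_pairs W (rev s @ s) = {x \<in> W \<times> W. rev s @ s = rev (fst x) @ snd x}"
      by (auto simp: hankel_pairs_def)
    then show "(\<Sum>(u, v)\<in>W \<times> W. if rev s @ s = rev u @ v then weight W s * Re (G u v h h) else 0)
        = weight W s * Re (\<Sum>(u, v)\<in>hankel_pairs W (rev s @ s). G u v h h)"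
      using W by (auto simp: case_prod_unfold sum_distrib_left sum.inter_filter intro!: sum.cong)
  qed
  finally show ?thesis
    unfolding T_def a_def by simp
qed simp


section \<open>Pointwise limits along a finer filter\<close>

text \<open>A convergent net of operators in the weak topology need not be bounded, so there is no single
  compact set that eventually contains the kernels. Boundedness of each coordinate separately is
  enough: clipping each coordinate at its own bound maps into a product of discs, which is compact by
  Tychonoff's theorem, and every single coordinate is eventually not affected by the clipping.\<close>

lemma pointwise_convergent_refinement:
  fixes f :: "'q \<Rightarrow> 'i \<Rightarrow> complex"
  assumes F: "F \<noteq> bot" and bounded: "\<And>i. \<exists>B. eventually (\<lambda>q. cmod (f q i) \<le> B) F"
  obtains F' x where "F' \<le> F" "F' \<noteq> bot" "\<And>i. ((\<lambda>q. f q i) \<longlongrightarrow> x i) F'"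
proof -
  obtain B where B: "\<And>i. eventually (\<lambda>q. cmod (f q i) \<le> B i) F"
    using bounded by metis
  define clip where "clip q i = (if cmod (f q i) \<le> B i then f q i else 0)" for q i
  define K where "K = (\<Pi>\<^sub>E i\<in>UNIV. cball (0::complex) \<bar>B i\<bar>)"
  have "compactin (product_topology (\<lambda>i. euclidean) UNIV) K"
    unfolding K_def compactin_PiE by simp
  then have "compact K"
    by (simp add: euclidean_product_topology)
  moreover have "clip q \<in> K" for q
    by (auto simp: K_def clip_def PiE_UNIV_domain)
  moreover have "filtermap clip F \<noteq> bot"
    by (simp add: F filtermap_bot_iff)
  ultimately obtain x where x: "inf (nhds x) (filtermap clip F) \<noteq> bot"
    unfolding compact_filter by (metis always_eventually eventually_filtermap)
  define F' where "F' = inf F (filtercomap clip (nhds x))"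
  show ?thesis
  proof (rule that)
    show F'_le: "F' \<le> F"
      by (simp add: F'_def)
    show "F' \<noteq> bot"
    proof
      assume "F' = bot"
      then have "eventually (\<lambda>q. False) F'"
        by simp
      then obtain Q N where "eventually Q F" "eventually N (nhds x)"
        and QN: "\<And>q. Q q \<Longrightarrow> \<not> N (clip q)"
        unfolding F'_def eventually_inf eventually_filtercomap by blast
      then have "eventually (\<lambda>y. \<not> N y) (filtermap clip F)"
        by (auto simp: eventually_filtermap elim: eventually_mono)
      with \<open>eventually N (nhds x)\<close> have "eventually (\<lambda>y. False) (inf (nhds x) (filtermap clip F))"
        unfolding eventually_inf by blast
      with x show False
        by (simp add: eventually_False)
    qed
    have "filterlim clip (nhds x) F'"
      unfolding F'_def by (rule filterlim_mono [OF filterlim_filtercomap order_refl inf_le2])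
    then have "((\<lambda>q. clip q i) \<longlongrightarrow> x i) F'" for i
      by (rule continuous_on_tendsto_compose [OF continuous_on_product_coordinates [of i]]) auto
    moreover have "eventually (\<lambda>q. clip q i = f q i) F'" for i
      using filter_leD [OF F'_le B [of i]] by (rule eventually_mono) (simp add: clip_def)
    ultimately show "((\<lambda>q. f q i) \<longlongrightarrow> x i) F'" for i
      by (rule Lim_transform_eventually)
  qed
qed

lemma psd_kernel_limit:
  fixes f :: "'q \<Rightarrow> 'i \<Rightarrow> 'i \<Rightarrow> 'h::complex_hilbert_space \<Rightarrow> 'h \<Rightarrow> complex"
  assumes F: "F \<noteq> bot" and f: "eventually (\<lambda>q. psd_kernel W (f q)) F"
    and lim: "\<And>u v h k. u \<in> W \<Longrightarrow> v \<in> W \<Longrightarrow> ((\<lambda>q. f q u v h k) \<longlongrightarrow> G u v h k) F"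
  shows "psd_kernel W G"
  unfolding psd_kernel_def sesquilinear_def
proof (intro conjI ballI allI)
  have unique: "a = b" if "(\<phi> \<longlongrightarrow> a) F" "(\<psi> \<longlongrightarrow> b) F" "\<And>q. psd_kernel W (f q) \<Longrightarrow> \<phi> q = \<psi> q"
    for a b :: complex and \<phi> \<psi>
  proof -
    have "eventually (\<lambda>q. \<phi> q = \<psi> q) F"
      using f by (rule eventually_mono) (rule that(3))
    then have "(\<psi> \<longlongrightarrow> a) F"
      by (rule Lim_transform_eventually [OF that(1)])
    with that(2) show ?thesis
      using F tendsto_unique by blast
  qed
  fix u v assume u: "u \<in> W" and v: "v \<in> W"
  note D = sesquilinearD [OF psd_kernelD(1) [OF _ u v]]
  show "G u v (x + y) z = G u v x z + G u v y z" for x y z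
    by (rule unique [OF lim [OF u v] tendsto_add [OF lim [OF u v] lim [OF u v]]]) (rule D)
  show "G u v (cscale c x) z = c * G u v x z" for c x z
    by (rule unique [OF lim [OF u v] tendsto_mult_left [OF lim [OF u v]]]) (rule D)
  show "G u v x (y + z) = G u v x y + G u v x z" for x y z
    by (rule unique [OF lim [OF u v] tendsto_add [OF lim [OF u v] lim [OF u v]]]) (rule D)
  show "G u v x (cscale c z) = cnj c * G u v x z" for c x z
    by (rule unique [OF lim [OF u v] tendsto_mult_left [OF lim [OF u v]]]) (rule D)
  show "G u v h k = cnj (G v u k h)" for h k
    by (rule unique [OF lim [OF u v] tendsto_cnj [OF lim [OF v u]]]) (rule psd_kernelD(2) [OF _ u v])
next
  fix x
  have "((\<lambda>q. Re (\<Sum>u\<in>W. \<Sum>v\<in>W. f q u v (x v) (x u))) \<longlongrightarrow> Re (\<Sum>u\<in>W. \<Sum>v\<in>W. G u v (x v) (x u))) F"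
    by (intro tendsto_Re tendsto_sum lim)
  moreover have "eventually (\<lambda>q. 0 \<le> Re (\<Sum>u\<in>W. \<Sum>v\<in>W. f q u v (x v) (x u))) F"
    using f by (rule eventually_mono) (rule psd_kernelD(3))
  ultimately show "0 \<le> Re (\<Sum>u\<in>W. \<Sum>v\<in>W. G u v (x v) (x u))"
    using F by (intro tendsto_lowerbound)
qed


section \<open>The cone of sums of squares is closed\<close>

lemma topspace_product_wot: "topspace (product_wot g D) = ncpolys_deg g D"
proof -
  have "restrict p (words g D) \<in> topspace (product_topology (\<lambda>_. weak_operator_topology) (words g D))"
    if "p \<in> ncpolys_deg g D" for p :: "'a ncpoly"
    using ncpolys_degD(1) [OF that] by (auto simp: weak_operator_topology_def topspace_pullback_topology)
  then show ?thesis
    unfolding product_wot_def topspace_pullback_topology by blast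
qed

lemma closure_of_filter:
  assumes "p \<in> X closure_of C"
  obtains F where "F \<noteq> bot" "eventually (\<lambda>q. q \<in> C) F" "limitin X (\<lambda>q. q) p F"
proof (rule that)
  have p: "p \<in> topspace X" "\<And>T. openin X T \<Longrightarrow> p \<in> T \<Longrightarrow> \<exists>q\<in>C. q \<in> T"
    using assms by (auto simp: in_closure_of)
  let ?F = "inf (nhdsin X p) (principal C)"
  show "?F \<noteq> bot"
    using p by (auto simp: trivial_limit_def eventually_inf_principal eventually_nhdsin)
  show "eventually (\<lambda>q. q \<in> C) ?F"
    using p by (auto simp: eventually_inf_principal eventually_nhdsin)
  show "limitin X (\<lambda>q. q) p ?F"
    using p(1) by (auto simp: limitin_def eventually_inf_principal eventually_nhdsin)
qed

text \<open>The factorization of the kernel is indexed by words. Since \<open>num_words g d\<close> counts these words,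
  each of its rows becomes one of the squares in the definition of the cone.\<close>

lemma sos_cone_if_psd_kernel:
  fixes p :: "'h::complex_hilbert_space ncpoly"
  assumes p: "p \<in> ncpolys_deg g D" and dD: "2 * d \<le> D"
    and G: "psd_kernel (words g d) G" and c: "0 \<le> c"
    and bound: "\<And>u h. u \<in> words g d \<Longrightarrow> Re (G u u h h) \<le> c * (norm h)\<^sup>2"
    and coeff: "\<And>w h k. w \<in> words g D \<Longrightarrow>
      cinner (blinfun_apply (p w) h) k = (\<Sum>(u, v)\<in>hankel_pairs (words g d) w. G u v h k)"
  shows "p \<in> sos_cone g d"
proof -
  let ?W = "words g d"
  obtain R where R: "\<And>i u. i \<in> ?W \<Longrightarrow> u \<in> ?W \<Longrightarrow> R i u \<in> bounded_ops"
      "\<And>u v h k. u \<in> ?W \<Longrightarrow> v \<in> ?W \<Longrightarrow>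
        G u v h k = (\<Sum>i\<in>?W. cinner (blinfun_apply (R i v) h) (blinfun_apply (R i u) k))"
    using psd_kernel_factorization [OF finite_words G c bound] by blast
  obtain e where e: "bij_betw e {1..num_words g d} ?W"
    using finite_same_card_bij [of "{1..num_words g d}" ?W] finite_words [of g d]
      card_words [of g d] by auto
  define r where "r i w = (if w \<in> ?W then R (e i) w else 0)" for i w
  have r: "r i \<in> ncpolys_deg g d" if "i \<in> {1..num_words g d}" for i
    using bij_betwE [OF e] that
    by (intro ncpolys_degI) (auto simp: r_def R(1) bounded_ops_zero)
  have gram: "gram {1..num_words g d} r u v h k = G u v h k" if "u \<in> ?W" "v \<in> ?W" for u v h k
    unfolding gram_def R(2) [OF that]
    by (simp add: r_def that sum.reindex_bij_betw [OF e, symmetric])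
  have "p = (\<lambda>w. \<Sum>i=1..num_words g d. nc_mult (nc_adj (r i)) (r i) w)"
  proof (rule ext, rule blinfun_eqI, rule cinner_eqI)
    fix w h k
    have "cinner (blinfun_apply (\<Sum>i=1..num_words g d. nc_mult (nc_adj (r i)) (r i) w) h) k
        = (\<Sum>(u, v)\<in>hankel_pairs ?W w. gram {1..num_words g d} r u v h k)"
      by (rule cinner_sum_nc_squares) (rule r)
    also have "\<dots> = (\<Sum>(u, v)\<in>hankel_pairs ?W w. G u v h k)"
      by (rule sum.cong) (auto simp: hankel_pairs_def gram simp del: One_nat_def)
    also have "\<dots> = cinner (blinfun_apply (p w) h) k"
      using coeff [of w h k] ncpolys_degD(2) [OF p, of w] hankel_pairs_words_degree [OF dD, of w]
      by (cases "w \<in> words g D") auto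
    finally show "cinner (blinfun_apply (p w) h) k
        = cinner (blinfun_apply (\<Sum>i=1..num_words g d. nc_mult (nc_adj (r i)) (r i) w) h) k"
      by (rule sym)
  qed
  with r show ?thesis
    unfolding sos_cone_def by blast
qed

lemma sos_cone_imp_kernel:
  assumes "p \<in> sos_cone g d"
  shows "\<exists>G. psd_kernel (words g d) G \<and> (\<forall>w h k.
    cinner (blinfun_apply (p w) h) k = (\<Sum>(u, v)\<in>hankel_pairs (words g d) w. G u v h k))"
proof -
  obtain r where r: "\<And>i. i \<in> {1..num_words g d} \<Longrightarrow> r i \<in> ncpolys_deg g d"
    and p: "p = (\<lambda>w. \<Sum>i=1..num_words g d. nc_mult (nc_adj (r i)) (r i) w)"
    using assms unfolding sos_cone_def by blast
  show ?thesis
  proof (intro exI conjI allI)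
    show "psd_kernel (words g d) (gram {1..num_words g d} r)"
      by (intro psd_kernel_gram ncpolys_degD(1) [OF r])
    show "cinner (blinfun_apply (p w) h) k
        = (\<Sum>(u, v)\<in>hankel_pairs (words g d) w. gram {1..num_words g d} r u v h k)" for w h k
      unfolding p by (rule cinner_sum_nc_squares) (rule r)
  qed
qed

lemma weight_ge_1:
  assumes "finite W" "u \<in> W"
  shows "1 \<le> weight W u"
proof -
  have "card W \<noteq> 0" using assms by auto
  then show ?thesis unfolding weight_def by (intro one_le_power) simp
qed

text \<open>The bound \<open>b q h\<close> on the diagonal of the kernel of \<open>q\<close> at the vector \<open>h\<close> is a combination of
  coefficients of \<open>q\<close>, hence converges to \<open>b p h\<close>. This bounds the kernels vector by vector
  along the filter, and for the limit kernel it becomes the uniform bound \<open>c \<parallel>h\<parallel>\<^sup>2\<close>, because the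
  coefficients of \<open>p\<close> are bounded operators.\<close>

lemma sos_cone_closed_under_limits:
  fixes p :: "'h::complex_hilbert_space ncpoly"
  assumes dD: "2 * d \<le> D" and F: "F \<noteq> bot" and C: "eventually (\<lambda>q. q \<in> sos_cone g d) F"
    and lim: "limitin (product_wot g D) (\<lambda>q. q) p F"
  shows "p \<in> sos_cone g d"
proof -
  let ?W = "words g d"
  have p: "p \<in> ncpolys_deg g D"
    using lim by (simp add: limitin_product_wot)
  have lim_coeff: "((\<lambda>q. cinner (blinfun_apply (q w) h) k) \<longlongrightarrow> cinner (blinfun_apply (p w) h) k) F"
    if "w \<in> words g D" for w h k
    using lim that by (simp add: limitin_product_wot limitin_weak_operator_topology)
  have "\<forall>q\<in>sos_cone g d. \<exists>G. psd_kernel ?W G \<and> (\<forall>w h k.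
      cinner (blinfun_apply ((q :: 'h ncpoly) w) h) k
        = (\<Sum>(u, v)\<in>hankel_pairs ?W w. G u v h k))"
    by (intro ballI sos_cone_imp_kernel)
  from bchoice [OF this] obtain \<G> where \<G>_all: "\<forall>q\<in>(sos_cone g d :: 'h ncpoly set). psd_kernel ?W (\<G> q) \<and> (\<forall>w h k.
      cinner (blinfun_apply (q w) h) k = (\<Sum>(u, v)\<in>hankel_pairs ?W w. \<G> q u v h k))" ..
  have \<G>: "psd_kernel ?W (\<G> q)"
    "cinner (blinfun_apply (q w) h) k = (\<Sum>(u, v)\<in>hankel_pairs ?W w. \<G> q u v h k)"
    if "q \<in> sos_cone g d" for q w h k
    using \<G>_all that by simp_all
  define b where "b q h = 2 * (\<Sum>s\<in>?W. weight ?W s * Re (cinner (blinfun_apply (q (rev s @ s)) h) h))"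
    for q :: "'h ncpoly" and h
  have diag_le: "Re (\<G> q u u h h) \<le> b q h" if q: "q \<in> sos_cone g d" and u: "u \<in> ?W" for q u h
  proof -
    note nonneg = psd_kernel_diag_nonneg [OF \<G>(1) [OF q] finite_words]
    have "Re (\<G> q u u h h) \<le> weight ?W u * Re (\<G> q u u h h)"
      using mult_right_mono [OF weight_ge_1 [OF finite_words u] nonneg [OF u]] by simp
    also have "\<dots> \<le> (\<Sum>u\<in>?W. weight ?W u * Re (\<G> q u u h h))"
      by (rule member_le_sum [OF u]) (simp_all add: nonneg finite_words weight_def)
    also have "\<dots> \<le> b q h"
      unfolding b_def \<G>(2) [OF q] by (rule weighted_diagonal_le [OF \<G>(1) [OF q] finite_words])
    finally show ?thesis .
  qed
  have b_lim: "((\<lambda>q. b q h) \<longlongrightarrow> b p h) F" for h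
    unfolding b_def
  proof (intro tendsto_intros lim_coeff)
    show "rev s @ s \<in> words g D" if "s \<in> ?W" for s
      using that dD by (simp add: words_def)
  qed
  have b_ev: "eventually (\<lambda>q. b q h \<le> b p h + 1) F" for h
    using order_tendstoD(2) [OF b_lim, of h "b p h + 1"] by (rule eventually_mono) auto

  define f where "f q = (\<lambda>(u, v, h, k). if u \<in> ?W \<and> v \<in> ?W then \<G> q u v h k else 0)" for q
  have "\<exists>B. eventually (\<lambda>q. cmod (f q i) \<le> B) F" for i
  proof -
    obtain u v h k where i: "i = (u, v, h, k)"
      by (metis prod_cases4)
    show ?thesis
    proof (cases "u \<in> ?W \<and> v \<in> ?W")
      case False
      then show ?thesis
        by (intro exI [of _ 0]) (auto simp: i f_def)
    next
      case True
      have "eventually (\<lambda>q. cmod (f q i) \<le> \<bar>b p h + 1\<bar> + \<bar>b p k + 1\<bar>) F"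
        using C b_ev [of h] b_ev [of k]
      proof eventually_elim
        case (elim q)
        note nonneg = psd_kernel_diag_nonneg [OF \<G>(1) [OF elim(1)] finite_words]
        have h: "Re (\<G> q v v h h) \<le> \<bar>b p h + 1\<bar>" and k: "Re (\<G> q u u k k) \<le> \<bar>b p k + 1\<bar>"
          using diag_le [OF elim(1), of v h] diag_le [OF elim(1), of u k] True elim(2,3) by auto
        have "(cmod (\<G> q u v h k))\<^sup>2 \<le> Re (\<G> q v v h h) * Re (\<G> q u u k k)"
          by (rule psd_kernel_Cauchy_Schwarz [OF \<G>(1) [OF elim(1)] finite_words])
            (use True in auto)
        also have "\<dots> \<le> \<bar>b p h + 1\<bar> * \<bar>b p k + 1\<bar>"
          using True by (intro mult_mono h k nonneg) auto
        also have "\<dots> \<le> (\<bar>b p h + 1\<bar> + \<bar>b p k + 1\<bar>)\<^sup>2"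
          unfolding power2_eq_square by (intro mult_mono) simp_all
        finally have "cmod (\<G> q u v h k) \<le> \<bar>b p h + 1\<bar> + \<bar>b p k + 1\<bar>"
          by (rule power2_le_imp_le) simp
        then show ?case
          using True by (simp add: i f_def)
      qed
      then show ?thesis by blast
    qed
  qed
  then obtain F' x where F': "F' \<le> F" "F' \<noteq> bot" and x: "\<And>i. ((\<lambda>q. f q i) \<longlongrightarrow> x i) F'"
    using pointwise_convergent_refinement [OF F, of f] by blast
  define G where "G u v h k = x (u, v, h, k)" for u v h k
  have G_lim: "((\<lambda>q. \<G> q u v h k) \<longlongrightarrow> G u v h k) F'" if "u \<in> ?W" "v \<in> ?W" for u v h k
    using x [of "(u, v, h, k)"] that by (simp add: f_def G_def)
  have C': "eventually (\<lambda>q. q \<in> sos_cone g d) F'"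
    by (rule filter_leD [OF F'(1) C])
  define c where "c = 2 * (\<Sum>s\<in>?W. weight ?W s * norm (p (rev s @ s)))"
  have weight0: "0 \<le> weight ?W s" for s
    by (simp add: weight_def)
  have c: "0 \<le> c"
    unfolding c_def by (intro mult_nonneg_nonneg sum_nonneg weight0) auto
  have b_le: "b p h \<le> c * (norm h)\<^sup>2" for h
  proof -
    have "Re (cinner (blinfun_apply T h) h) \<le> norm T * (norm h)\<^sup>2" for T :: "'h \<Rightarrow>\<^sub>L 'h"
    proof -
      have "Re (cinner (blinfun_apply T h) h) \<le> norm (blinfun_apply T h) * norm h"
        by (rule order_trans [OF complex_Re_le_cmod cmod_cinner_le])
      also have "\<dots> \<le> (norm T * norm h) * norm h"
        by (intro mult_right_mono norm_blinfun) simp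
      finally show ?thesis by (simp add: power2_eq_square mult.assoc)
    qed
    then have "(\<Sum>s\<in>?W. weight ?W s * Re (cinner (blinfun_apply (p (rev s @ s)) h) h))
        \<le> (\<Sum>s\<in>?W. weight ?W s * (norm (p (rev s @ s)) * (norm h)\<^sup>2))"
      by (intro sum_mono mult_left_mono weight0)
    then show ?thesis
      by (simp add: b_def c_def sum_distrib_right mult.assoc)
  qed
  show ?thesis
  proof (rule sos_cone_if_psd_kernel [OF p dD _ c])
    show "psd_kernel ?W G"
    proof (rule psd_kernel_limit [OF F'(2) _ G_lim])
      show "eventually (\<lambda>q. psd_kernel ?W (\<G> q)) F'"
        using C' by (rule eventually_mono) (rule \<G>(1))
    qed
    show "Re (G u u h h) \<le> c * (norm h)\<^sup>2" if u: "u \<in> ?W" for u h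
    proof -
      have "eventually (\<lambda>q. Re (\<G> q u u h h) \<le> b q h) F'"
        using C' by (rule eventually_mono) (rule diag_le [OF _ u])
      then have "Re (G u u h h) \<le> b p h"
        by (rule tendsto_le [OF F'(2) tendsto_mono [OF F'(1) b_lim] tendsto_Re [OF G_lim [OF u u]]])
      then show ?thesis
        using b_le [of h] by linarith
    qed
    show "cinner (blinfun_apply (p w) h) k = (\<Sum>(u, v)\<in>hankel_pairs ?W w. G u v h k)"
      if w: "w \<in> words g D" for w h k
    proof (rule tendsto_unique [OF F'(2) tendsto_mono [OF F'(1) lim_coeff [OF w]]])
      have "((\<lambda>q. \<Sum>(u, v)\<in>hankel_pairs ?W w. \<G> q u v h k)
          \<longlongrightarrow> (\<Sum>(u, v)\<in>hankel_pairs ?W w. G u v h k)) F'"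
        unfolding case_prod_unfold
        by (intro tendsto_sum G_lim) (auto simp: hankel_pairs_def)
      moreover have "eventually (\<lambda>q. (\<Sum>(u, v)\<in>hankel_pairs ?W w. \<G> q u v h k)
          = cinner (blinfun_apply (q w) h) k) F'"
        using C' by (rule eventually_mono) (simp add: \<G>(2))
      ultimately show "((\<lambda>q. cinner (blinfun_apply (q w) h) k)
          \<longlongrightarrow> (\<Sum>(u, v)\<in>hankel_pairs ?W w. G u v h k)) F'"
        by (rule Lim_transform_eventually)
    qed
  qed
qed

theorem proposition4p1:
  fixes g d D :: nat
  assumes "0 < g" and "0 < d" and "2 * d \<le> D"
  shows "closedin (product_wot g D)
           (sos_cone g d :: 'h::complex_hilbert_space ncpoly set)"
  unfolding closure_of_subset_eq [symmetric] topspace_product_wot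
proof
  show "sos_cone g d \<subseteq> (ncpolys_deg g D :: 'h ncpoly set)"
    by (rule sos_cone_subset_ncpolys_deg [OF assms(3)])
  show "product_wot g D closure_of sos_cone g d \<subseteq> (sos_cone g d :: 'h ncpoly set)"
  proof
    fix p :: "'h ncpoly" assume "p \<in> product_wot g D closure_of sos_cone g d"
    then obtain F where "F \<noteq> bot" "eventually (\<lambda>q. q \<in> sos_cone g d) F"
        "limitin (product_wot g D) (\<lambda>q. q) p F"
      by (rule closure_of_filter)
    then show "p \<in> sos_cone g d"
      by (rule sos_cone_closed_under_limits [OF assms(3)])
  qed
qed

end
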